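(* Let $\alpha>1$, let $\nu$ be an angular measure, let $Z\sim\mathcal{MS}(\alpha,\nu)$, and let $h\in\mathcal{C}^1(\mathbb{R}_+^d)\cap\mathrm{Lip}_1(\mathbb{R}_+^d)$, with associated Stein solution $g_h$. (1) $g_h$ is $\alpha$-Lipschitz and for every $j\in\{1,\dots,d\}$ $$|\partial_jg_h(x)|\le\min\big(\alpha,(x^j)^\alpha\big),\qquad x\in\mathbb{R}_+^d .$$ (2) Consequently, $\mathbf{D}g_h(x)$ is well-defined and finite for every $x\in E_0$. (3) Assume furthermore that $h\in\mathrm{Lip}^{[2]}_1(\mathbb{R}_+^d)$. Then for every $j$, $\partial_jg_h$ is $C_{2,\alpha}$-Lipschitz, where $$C_{2,\alpha}=\int_0^\infty\Big((d-1)e^{-t/\alpha}+\alpha(e^t-1)^{-1/\alpha}\Big)\mathrm dt .$$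
   Context: Fix $d\ge 1$, $\mathbb{R}_+=[0,\infty)$. Operations on vectors (powers, inequalities) are coordinate-wise; $x\oplus y$ is the coordinate-wise maximum; $\|x\|_1=\sum_j|x^j|$; Lipschitz constants on $\mathbb{R}_+^d$ are with respect to $\|\cdot\|_1$. Let $E_0=[0,\infty)^d\setminus\{0\}$, $[0,x]=\prod_j[0,x^j]$ and $[0,x]^c$ its complement in $E_0$. Fix a norm $\|\cdot\|$ on $\mathbb{R}^d$ such that $\mathbf{S}_+^{d-1}=\{x\in\mathbb{R}_+^d:\|x\|=1\}\subseteq[0,1]^d$. An angular measure is a finite Borel measure $\nu$ on $\mathbf{S}_+^{d-1}$ with $\int u^j\,\mathrm d\nu(u)=1$ for $j=1,\dots,d$. For $\alpha>0$ the exponent measure $\mu$ is the pushforward of $\alpha r^{-\alpha-1}\mathrm dr\otimes\nu(\mathrm du)$ on $(0,\infty)\times\mathbf{S}_+^{d-1}$ by $(r,u)\mapsto r\,u^{1/\alpha}$. $\mathcal{MS}(\alpha,\nu)$ is the law of the max-stable random vector $Z$ on $(0,\infty)^d$ with $\mathbb{P}(Z\le z)=e^{-\mu([0,z]^c)}$, $z\in(0,\infty)^d$. $\mathrm{Lip}_1(\mathbb{R}_+^d)$ is the set of $h:\mathbb{R}_+^d\to\mathbb{R}$ with $|h(x)-h(y)|\le\|x-y\|_1$; $\mathrm{Lip}^{[2]}_1(\mathbb{R}_+^d)$ is the set of $h:\mathbb{R}_+^d\to\mathbb{R}$ such that $h$ and $\partial_jh$, for every $j$, are $1$-Lipschitz.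 The semi-group is $\mathbf{P}_t h(x)=\mathbb{E}\big[h\big(e^{-t/\alpha}x\oplus(1-e^{-t})^{1/\alpha}Z\big)\big]$. The Stein solution is $g_h(x)=-\int_0^\infty\big(\mathbf{P}_t h(x)-\mathbb{E}[h(Z)]\big)\mathrm dt$ (a convergent integral). Finally $\mathbf{D}f(x)=\int_{E_0}\big(f(x\oplus y)-f(x)\big)\,\mathrm d\mu(y)$. *)

theory Defs
  imports "HOL-Probability.Probability"
begin

text \<open>
  Vectors are elements of \<open>real ^ 'n\<close> with \<open>d = CARD('n)\<close>; \<open>\<le>\<close> and \<open>sup\<close> are the
  coordinate-wise order and maximum of the library. A function on the closed orthant is a
  function on \<open>real ^ 'n\<close> of which only the values on \<open>orthant\<close> are ever used.
\<close>

definition orthant :: "(real ^ 'n) set" where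
  "orthant = {0..}"

definition pos_orthant :: "(real ^ 'n) set" where
  "pos_orthant = {z. \<forall>j. 0 < z $ j}"

definition E0 :: "(real ^ 'n) set" where
  "E0 = orthant - {0}"

definition vec_powr :: "real ^ 'n \<Rightarrow> real \<Rightarrow> real ^ 'n" where
  "vec_powr u a = (\<chi> j. u $ j powr a)"

definition norm1 :: "real ^ 'n \<Rightarrow> real" where
  "norm1 x = (\<Sum>j\<in>UNIV. \<bar>x $ j\<bar>)"

definition is_norm :: "(real ^ 'n \<Rightarrow> real) \<Rightarrow> bool" where
  "is_norm N \<longleftrightarrow>
     (\<forall>x. 0 \<le> N x) \<and> (\<forall>x. N x = 0 \<longleftrightarrow> x = 0) \<and>
     (\<forall>c x. N (c *\<^sub>R x) = \<bar>c\<bar> * N x) \<and> (\<forall>x y. N (x + y) \<le> N x + N y)"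

definition pos_sphere :: "(real ^ 'n \<Rightarrow> real) \<Rightarrow> (real ^ 'n) set" where
  "pos_sphere N = {x \<in> orthant. N x = 1}"

definition angular_measure :: "(real ^ 'n \<Rightarrow> real) \<Rightarrow> (real ^ 'n) measure \<Rightarrow> bool" where
  "angular_measure N \<nu> \<longleftrightarrow>
     finite_measure \<nu> \<and> sets \<nu> = sets (restrict_space borel (pos_sphere N)) \<and>
     (\<forall>j. (\<integral>u. u $ j \<partial>\<nu>) = 1)"

definition radial_measure :: "real \<Rightarrow> real measure" where
  "radial_measure \<alpha> =
     density (restrict_space lborel {0<..}) (\<lambda>r. ennreal (\<alpha> * r powr (- \<alpha> - 1)))"

definition exponent_measure :: "real \<Rightarrow> (real ^ 'n) measure \<Rightarrow> (real ^ 'n) measure" where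
  "exponent_measure \<alpha> \<nu> =
     distr (radial_measure \<alpha> \<Otimes>\<^sub>M \<nu>) (restrict_space borel E0)
       (\<lambda>(r, u). r *\<^sub>R vec_powr u (1 / \<alpha>))"

definition max_stable_law :: "real \<Rightarrow> (real ^ 'n) measure \<Rightarrow> (real ^ 'n) measure \<Rightarrow> bool" where
  "max_stable_law \<alpha> \<nu> L \<longleftrightarrow>
     prob_space L \<and> sets L = sets (restrict_space borel pos_orthant) \<and>
     (\<forall>z\<in>pos_orthant. measure L {x \<in> space L. x \<le> z} =
        exp (- measure (exponent_measure \<alpha> \<nu>) (E0 - {0..z})))"

definition max_stable_vector ::
  "real \<Rightarrow> (real ^ 'n) measure \<Rightarrow> 'a measure \<Rightarrow> ('a \<Rightarrow> real ^ 'n) \<Rightarrow> bool" where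
  "max_stable_vector \<alpha> \<nu> M Z \<longleftrightarrow>
     Z \<in> measurable M (restrict_space borel pos_orthant) \<and>
     max_stable_law \<alpha> \<nu> (distr M (restrict_space borel pos_orthant) Z)"

definition lipschitz1 :: "real \<Rightarrow> (real ^ 'n \<Rightarrow> real) \<Rightarrow> bool" where
  "lipschitz1 C f \<longleftrightarrow>
     (\<forall>x\<in>orthant. \<forall>y\<in>orthant. \<bar>f x - f y\<bar> \<le> C * norm1 (x - y))"

definition upd :: "real ^ 'n \<Rightarrow> 'n \<Rightarrow> real \<Rightarrow> real ^ 'n" where
  "upd x j s = (\<chi> i. if i = j then s else x $ i)"

text \<open>
  Partial derivatives are taken within the orthant, hence are right derivatives at points
  with \<open>x $ j = 0\<close>.
\<close>

definition partial_diff :: "'n \<Rightarrow> (real ^ 'n \<Rightarrow> real) \<Rightarrow> real ^ 'n \<Rightarrow> bool" where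
  "partial_diff j f x \<longleftrightarrow> (\<lambda>s. f (upd x j s)) differentiable (at (x $ j) within {0..})"

definition partial :: "'n \<Rightarrow> (real ^ 'n \<Rightarrow> real) \<Rightarrow> real ^ 'n \<Rightarrow> real" where
  "partial j f x = vector_derivative (\<lambda>s. f (upd x j s)) (at (x $ j) within {0..})"

definition C1 :: "(real ^ 'n \<Rightarrow> real) set" where
  "C1 = {h. \<forall>j. (\<forall>x\<in>orthant. partial_diff j h x) \<and> continuous_on orthant (partial j h)}"

definition Lip1 :: "(real ^ 'n \<Rightarrow> real) set" where
  "Lip1 = {h. lipschitz1 1 h}"

definition Lip21 :: "(real ^ 'n \<Rightarrow> real) set" where
  "Lip21 = {h. lipschitz1 1 h \<and>
     (\<forall>j. (\<forall>x\<in>orthant. partial_diff j h x) \<and> lipschitz1 1 (partial j h))}"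

definition ms_semigroup ::
  "real \<Rightarrow> 'a measure \<Rightarrow> ('a \<Rightarrow> real ^ 'n) \<Rightarrow> real \<Rightarrow> (real ^ 'n \<Rightarrow> real) \<Rightarrow> real ^ 'n \<Rightarrow> real" where
  "ms_semigroup \<alpha> M Z t h x =
     (\<integral>\<omega>. h (sup (exp (- t / \<alpha>) *\<^sub>R x) ((1 - exp (- t)) powr (1 / \<alpha>) *\<^sub>R Z \<omega>)) \<partial>M)"

definition stein_solution ::
  "real \<Rightarrow> 'a measure \<Rightarrow> ('a \<Rightarrow> real ^ 'n) \<Rightarrow> (real ^ 'n \<Rightarrow> real) \<Rightarrow> real ^ 'n \<Rightarrow> real" where
  "stein_solution \<alpha> M Z h x =
     - (LINT t:{0<..}|lborel. ms_semigroup \<alpha> M Z t h x - (\<integral>\<omega>. h (Z \<omega>) \<partial>M))"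

definition D_op :: "real \<Rightarrow> (real ^ 'n) measure \<Rightarrow> (real ^ 'n \<Rightarrow> real) \<Rightarrow> real ^ 'n \<Rightarrow> real" where
  "D_op \<alpha> \<nu> f x = (\<integral>y. f (sup x y) - f x \<partial>exponent_measure \<alpha> \<nu>)"

text \<open>
  The Bochner integral is \<open>0\<close> for non-integrable functions; that the integral defining
  \<open>D_op\<close> converges absolutely, and has this value, has to be stated separately.
\<close>

definition D_op_finite :: "real \<Rightarrow> (real ^ 'n) measure \<Rightarrow> (real ^ 'n \<Rightarrow> real) \<Rightarrow> real ^ 'n \<Rightarrow> bool" where
  "D_op_finite \<alpha> \<nu> f x \<longleftrightarrow>
     has_bochner_integral (exponent_measure \<alpha> \<nu>) (\<lambda>y. f (sup x y) - f x) (D_op \<alpha> \<nu> f x)"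

definition C2 :: "'n itself \<Rightarrow> real \<Rightarrow> real" where
  "C2 _ \<alpha> = (LINT t:{0<..}|lborel.
     (real CARD('n) - 1) * exp (- t / \<alpha>) + \<alpha> * (exp t - 1) powr (- 1 / \<alpha>))"

end

theory Submission
  imports Defs
begin

text \<open>
  On the product of Lebesgue measure on the positive half-line with the probability space, the
  Stein solution is minus the integral of \<open>h (flow t \<omega> x) - h (Z \<omega>)\<close>, where
  \<open>flow t \<omega> x\<close> is the maximum of \<open>a x\<close> and \<open>b Z\<close> with \<open>a = exp (- t / \<alpha>)\<close> and
  \<open>b = (1 - exp (- t)) powr (1 / \<alpha>)\<close>. The map is \<open>a\<close>-Lipschitz in \<open>x\<close>, which gives the
  Lipschitz constant \<open>\<alpha>\<close>. Its \<open>j\<close>-th partial derivative is \<open>a\<close> on the event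
  \<open>b Z\<^sup>j \<le> a x\<^sup>j\<close> and \<open>0\<close> off it. As \<open>Z\<^sup>j\<close> is Frechet distributed, this event has probability
  \<open>exp (- (exp t - 1) (x\<^sup>j) powr - \<alpha>) \<le> exp (- t (x\<^sup>j) powr - \<alpha>)\<close>, whose integral in \<open>t\<close> is
  \<open>(x\<^sup>j) powr \<alpha>\<close>. Applied to increments this makes \<open>y \<mapsto> g (sup x y) - g x\<close> integrable. For the
  Lipschitz bound on the partial derivatives, the change of \<open>\<partial>\<^sub>j h\<close> contributes \<open>a\<^sup>2\<close> and the change
  of the event at most \<open>a\<close> times \<open>a / b = (exp t - 1) powr (- 1 / \<alpha>)\<close> times the maximum of the
  Frechet density; their sum is below \<open>\<alpha> a / b\<close> for every \<open>t\<close>.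
\<close>

section \<open>The radial measure\<close>

lemma vec_powr_nth [simp]: "vec_powr u a $ j = u $ j powr a"
  by (simp add: vec_powr_def)

lemma orthant_iff: "x \<in> orthant \<longleftrightarrow> (\<forall>j. 0 \<le> x $ j)"
  by (simp add: orthant_def less_eq_vec_def)

lemma sup_vec_nth [simp]: "sup x y $ j = max (x $ j) (y $ j :: real)"
  by (simp add: sup_vec_def sup_real_def)

lemma space_radial [simp]: "space (radial_measure \<alpha>) = {0<..}"
  by (simp add: radial_measure_def space_restrict_space)

lemma sets_radial [measurable_cong]: "sets (radial_measure \<alpha>) = sets (restrict_space borel {0<..})"
  by (simp add: radial_measure_def sets_restrict_space)

lemma sigma_finite_radial: "sigma_finite_measure (radial_measure \<alpha>)"
proof -
  interpret sigma_finite_measure "restrict_space lborel {0::real<..}"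
    by (rule sigma_finite_measure_restrict_space) (auto simp: sigma_finite_lborel)
  show ?thesis
    unfolding radial_measure_def
    by (subst sigma_finite_iff_density_finite) (auto intro!: measurable_restrict_space1)
qed

lemma nn_integral_radial:
  assumes "f \<in> borel_measurable borel"
  shows "(\<integral>\<^sup>+ r. f r \<partial>radial_measure \<alpha>) =
    (\<integral>\<^sup>+ r. ennreal (\<alpha> * r powr (- \<alpha> - 1)) * f r * indicator {0<..} r \<partial>lborel)"
  unfolding radial_measure_def using assms
  by (subst nn_integral_density)
     (auto intro!: measurable_restrict_space1 simp: nn_integral_restrict_space)

text \<open>The antiderivative \<open>- (r powr - a)\<close> vanishes at infinity. The case
  \<open>a = \<alpha>\<close> gives the tail of the radial measure; \<open>a = \<alpha> - 1\<close>,
  positive because \<alpha> > 1, governs first moments.\<close>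

lemma nn_integral_powr_atLeast:
  fixes a c :: real
  assumes "0 < a" "0 < c"
  shows "(\<integral>\<^sup>+ r. ennreal (a * r powr (- a - 1)) * indicator {c..} r \<partial>lborel) = ennreal (c powr - a)"
proof -
  have "(\<integral>\<^sup>+ r. ennreal (a * r powr (- a - 1)) * indicator {c..} r \<partial>lborel)
      = ennreal (0 - (- (c powr - a)))"
  proof (rule nn_integral_FTC_atLeast)
    show "((\<lambda>r. - (r powr - a)) has_real_derivative a * r powr (- a - 1)) (at r)" if "c \<le> r" for r
      using that assms by (auto intro!: derivative_eq_intros)
    show "((\<lambda>r. - (r powr - a)) \<longlongrightarrow> 0) at_top"
      using tendsto_minus[OF tendsto_neg_powr[of "- a" "\<lambda>x. x" at_top, OF _ filterlim_ident]] assms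
      by simp
  qed (use assms in auto)
  then show ?thesis by simp
qed

lemma nn_integral_radial_greaterThan:
  assumes "0 < \<alpha>" "0 < c"
  shows "(\<integral>\<^sup>+ r. indicator {c<..} r \<partial>radial_measure \<alpha>) = ennreal (c powr - \<alpha>)"
proof -
  have "(\<integral>\<^sup>+ r. indicator {c<..} r \<partial>radial_measure \<alpha>) =
     (\<integral>\<^sup>+ r. ennreal (\<alpha> * r powr (- \<alpha> - 1)) * indicator {c<..} r * indicator {0<..} r \<partial>lborel)"
    by (subst nn_integral_radial) auto
  also have "\<dots> = (\<integral>\<^sup>+ r. ennreal (\<alpha> * r powr (- \<alpha> - 1)) * indicator {c..} r \<partial>lborel)"
    by (rule nn_integral_cong_AE, rule AE_mp[OF AE_lborel_singleton[of c]])
       (use assms in \<open>auto split: split_indicator\<close>)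
  finally show ?thesis using nn_integral_powr_atLeast[OF assms] by simp
qed

text \<open>The two branches of the minimum tame the two ends of the density:
  \<open>r powr \<alpha>\<close> cancels the singularity at 0 and leaves the constant \<alpha>,
  while the bound \<alpha> leaves a multiple of \<open>r powr - \<alpha>\<close> at infinity,
  integrable as \<alpha> > 1.\<close>

lemma nn_integral_radial_min_finite:
  assumes "1 < \<alpha>"
  shows "(\<integral>\<^sup>+ r. ennreal (r * min \<alpha> (r powr \<alpha>)) \<partial>radial_measure \<alpha>) < \<infinity>"
proof -
  have eq: "(\<integral>\<^sup>+ r. ennreal (r * min \<alpha> (r powr \<alpha>)) \<partial>radial_measure \<alpha>)
      = (\<integral>\<^sup>+ r. ennreal (\<alpha> * r powr (- \<alpha> - 1)) * ennreal (r * min \<alpha> (r powr \<alpha>)) * indicator {0<..} r \<partial>lborel)"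
    by (rule nn_integral_radial) auto
  \<comment> \<open>The cut is at \<open>r = 1\<close>. The factor
    \<open>\<alpha>\<^sup>2 / (\<alpha> - 1)\<close> brings the tail into the normalised form of
    \<open>nn_integral_powr_atLeast\<close> with exponent \<open>\<alpha> - 1\<close>.\<close>
  have le: "ennreal (\<alpha> * r powr (- \<alpha> - 1)) * ennreal (r * min \<alpha> (r powr \<alpha>)) * indicator {0<..} r
      \<le> ennreal \<alpha> * indicator {0..1} r
         + ennreal (\<alpha>\<^sup>2 / (\<alpha> - 1)) * (ennreal ((\<alpha> - 1) * r powr (- (\<alpha> - 1) - 1)) * indicator {1..} r)" for r
  proof (cases "0 < r")
    case True
    have 1: "(\<alpha> * r powr (- \<alpha> - 1)) * (r * min \<alpha> (r powr \<alpha>)) \<le> \<alpha>"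
    proof -
      have "(\<alpha> * r powr (- \<alpha> - 1)) * (r * min \<alpha> (r powr \<alpha>)) \<le> (\<alpha> * r powr (- \<alpha> - 1)) * (r * r powr \<alpha>)"
        using True assms by (intro mult_left_mono) auto
      also have "\<dots> = \<alpha>" using True by (simp add: powr_diff powr_minus field_simps)
      finally show ?thesis .
    qed
    have 2: "(\<alpha> * r powr (- \<alpha> - 1)) * (r * min \<alpha> (r powr \<alpha>)) \<le> \<alpha>\<^sup>2 / (\<alpha> - 1) * ((\<alpha> - 1) * r powr (- (\<alpha> - 1) - 1))"
    proof -
      have "(\<alpha> * r powr (- \<alpha> - 1)) * (r * min \<alpha> (r powr \<alpha>)) \<le> (\<alpha> * r powr (- \<alpha> - 1)) * (r * \<alpha>)"
        using True assms by (intro mult_left_mono) auto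
      also have "\<dots> = \<alpha>\<^sup>2 / (\<alpha> - 1) * ((\<alpha> - 1) * r powr (- (\<alpha> - 1) - 1))"
        using True assms by (simp add: powr_diff powr_minus field_simps power2_eq_square)
      finally show ?thesis .
    qed
    show ?thesis
    proof (cases "r < 1")
      case r: True
      then show ?thesis using 1 True assms by (auto simp: ennreal_mult[symmetric] intro!: ennreal_leI)
    next
      case r: False
      have "ennreal (\<alpha> * r powr (- \<alpha> - 1)) * ennreal (r * min \<alpha> (r powr \<alpha>)) \<le>
         ennreal (\<alpha>\<^sup>2 / (\<alpha> - 1)) * (ennreal ((\<alpha> - 1) * r powr (- (\<alpha> - 1) - 1)))"
        using 2 True assms by (subst (1 2) ennreal_mult[symmetric]) (auto intro!: ennreal_leI)
      then show ?thesis using True r by (auto intro!: add_increasing)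
    qed
  qed auto
  have "(\<integral>\<^sup>+ r. ennreal (r * min \<alpha> (r powr \<alpha>)) \<partial>radial_measure \<alpha>)
     \<le> (\<integral>\<^sup>+ r. ennreal \<alpha> * indicator {0..1} r
         + ennreal (\<alpha>\<^sup>2 / (\<alpha> - 1)) * (ennreal ((\<alpha> - 1) * r powr (- (\<alpha> - 1) - 1)) * indicator {1..} r) \<partial>lborel)"
    unfolding eq by (intro nn_integral_mono le)
  also have "\<dots> = ennreal \<alpha> + ennreal (\<alpha>\<^sup>2 / (\<alpha> - 1)) * ennreal (1 powr - (\<alpha> - 1))"
    using assms nn_integral_powr_atLeast[of "\<alpha> - 1" 1]
    by (subst nn_integral_add) (auto simp: nn_integral_cmult)
  also have "\<dots> < \<infinity>" by (simp add: ennreal_mult_less_top)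
  finally show ?thesis .
qed

section \<open>The exponent measure\<close>

lemma borel_measurable_vec_powr [measurable]: "(\<lambda>u. vec_powr u a) \<in> borel_measurable borel"
  by (subst borel_measurable_euclidean_space) (auto simp: Basis_vec_def inner_axis)

locale angular_setting =
  fixes \<alpha> :: real and N :: "real ^ 'n \<Rightarrow> real" and \<nu> :: "(real ^ 'n) measure"
  assumes norm_N: "is_norm N"
    and sphere_le_1: "pos_sphere N \<subseteq> {0..1}"
    and alpha_gt_1: "1 < \<alpha>"
    and angular: "angular_measure N \<nu>"
begin

sublocale \<nu>: finite_measure \<nu>
  using angular by (simp add: angular_measure_def)

lemma sets_nu [measurable_cong]: "sets \<nu> = sets (restrict_space borel (pos_sphere N))"
  using angular by (simp add: angular_measure_def)

lemma space_nu: "space \<nu> = pos_sphere N"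
  using sets_eq_imp_space_eq[OF sets_nu] by (simp add: space_restrict_space)

lemma in_space_nuD:
  assumes "u \<in> space \<nu>"
  shows "0 \<le> u $ j" "u $ j \<le> 1" "u \<noteq> 0"
proof -
  have u: "u \<in> pos_sphere N" using assms space_nu by simp
  then show "0 \<le> u $ j" "u $ j \<le> 1"
    using sphere_le_1 by (auto simp: less_eq_vec_def)
  show "u \<noteq> 0" using u norm_N zero_neq_one unfolding pos_sphere_def is_norm_def
    by (metis (mono_tags, lifting) mem_Collect_eq)
qed

lemma borel_measurable_nu: "f \<in> borel_measurable borel \<Longrightarrow> f \<in> borel_measurable \<nu>"
  by (subst measurable_cong_sets[OF sets_nu refl]) (rule measurable_restrict_space1)

text \<open>The Bochner integral of a non-integrable function is 0, so the prescribed value 1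
  already forces integrability of the coordinate.\<close>

lemma nn_integral_nu_coord: "(\<integral>\<^sup>+ u. ennreal (u $ j) \<partial>\<nu>) = 1"
proof -
  have eq: "(\<integral>u. u $ j \<partial>\<nu>) = 1" using angular by (simp add: angular_measure_def)
  then have "integrable \<nu> (\<lambda>u. u $ j)"
    using not_integrable_integral_eq by force
  then show ?thesis
    using nn_integral_eq_integral[of \<nu> "\<lambda>u. u $ j"] eq in_space_nuD by (auto simp: AE_I2)
qed

sublocale pair_sigma_finite "radial_measure \<alpha>" \<nu>
  unfolding pair_sigma_finite_def
  using sigma_finite_radial \<nu>.sigma_finite_measure_axioms by auto

text \<open>The image misses the origin because a point of the sphere has a nonzero coordinate,
  which stays nonzero under the power and the scaling by \<open>r > 0\<close>.\<close>

lemma measurable_polar: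
  "(\<lambda>(r, u). r *\<^sub>R vec_powr u (1 / \<alpha>)) \<in> radial_measure \<alpha> \<Otimes>\<^sub>M \<nu> \<rightarrow>\<^sub>M restrict_space borel E0"
proof (rule measurable_restrict_space2)
  show "(\<lambda>(r, u). r *\<^sub>R vec_powr u (1 / \<alpha>)) \<in> space (radial_measure \<alpha> \<Otimes>\<^sub>M \<nu>) \<rightarrow> E0"
  proof safe
    fix r :: real and u assume "(r, u) \<in> space (radial_measure \<alpha> \<Otimes>\<^sub>M \<nu>)"
    then have r: "0 < r" and u: "u \<in> space \<nu>" by (auto simp: space_pair_measure)
    obtain j where "u $ j \<noteq> 0" using in_space_nuD(3)[OF u] by (auto simp: vec_eq_iff)
    then have "(r *\<^sub>R vec_powr u (1 / \<alpha>)) $ j \<noteq> 0"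
      using r by simp
    then have "r *\<^sub>R vec_powr u (1 / \<alpha>) \<noteq> 0" by (metis zero_index)
    moreover have "r *\<^sub>R vec_powr u (1 / \<alpha>) \<in> orthant" using r by (simp add: orthant_iff)
    ultimately show "r *\<^sub>R vec_powr u (1 / \<alpha>) \<in> E0" by (simp add: E0_def)
  qed
  have [measurable]: "fst \<in> borel_measurable (radial_measure \<alpha> \<Otimes>\<^sub>M \<nu>)"
    by (rule measurable_compose[OF measurable_fst])
       (simp add: measurable_cong_sets[OF sets_radial refl] measurable_restrict_space1)
  have [measurable]: "snd \<in> borel_measurable (radial_measure \<alpha> \<Otimes>\<^sub>M \<nu>)"
    by (rule measurable_compose[OF measurable_snd]) (rule borel_measurable_nu, simp)
  show "(\<lambda>(r, u). r *\<^sub>R vec_powr u (1 / \<alpha>)) \<in> borel_measurable (radial_measure \<alpha> \<Otimes>\<^sub>M \<nu>)"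
    unfolding split_beta by measurable
qed

lemma sets_exponent [measurable_cong]:
    "sets (exponent_measure \<alpha> \<nu>) = sets (restrict_space borel E0)"
  and space_exponent [simp]: "space (exponent_measure \<alpha> \<nu>) = E0"
  by (simp_all add: exponent_measure_def space_restrict_space)

text \<open>Tonelli with the radius innermost: for a fixed \<open>u\<close> the inner integral runs
  along a ray and becomes one-dimensional.\<close>

lemma nn_integral_exponent:
  assumes f: "f \<in> borel_measurable (restrict_space borel E0)"
  shows "(\<integral>\<^sup>+ y. f y \<partial>exponent_measure \<alpha> \<nu>) =
    (\<integral>\<^sup>+ u. \<integral>\<^sup>+ r. f (r *\<^sub>R vec_powr u (1 / \<alpha>)) \<partial>radial_measure \<alpha> \<partial>\<nu>)"
proof -
  have "(\<integral>\<^sup>+ y. f y \<partial>exponent_measure \<alpha> \<nu>) =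
      (\<integral>\<^sup>+ p. f (case p of (r, u) \<Rightarrow> r *\<^sub>R vec_powr u (1 / \<alpha>)) \<partial>(radial_measure \<alpha> \<Otimes>\<^sub>M \<nu>))"
    unfolding exponent_measure_def using f by (intro nn_integral_distr[OF measurable_polar]) simp
  also have "\<dots> = (\<integral>\<^sup>+ u. \<integral>\<^sup>+ r. f (r *\<^sub>R vec_powr u (1 / \<alpha>)) \<partial>radial_measure \<alpha> \<partial>\<nu>)"
    by (subst nn_integral_snd[symmetric])
       (use measurable_compose[OF measurable_polar f] in simp_all)
  finally show ?thesis .
qed

lemma sets_coord_gt: "{y \<in> E0. s < y $ j} \<in> sets (restrict_space borel E0)"
proof -
  have "{y \<in> E0. s < y $ j} = E0 \<inter> {y. s < y $ j}" by auto
  then show ?thesis by (auto simp: sets_restrict_space intro!: imageI)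
qed

text \<open>If \<open>v = u $ j powr (1 / \<alpha>)\<close> is positive, the \<open>j\<close>-th
  coordinate exceeds \<open>s\<close> along the ray of \<open>u\<close> exactly for
  \<open>r > s / v\<close>, and these radii have mass \<open>s powr - \<alpha> * u $ j\<close>. The
  moment condition on \<nu> then integrates \<open>u $ j\<close> to 1.\<close>

lemma emeasure_exponent_coord_gt:
  assumes s: "0 < s"
  shows "emeasure (exponent_measure \<alpha> \<nu>) {y \<in> E0. s < y $ j} = ennreal (s powr - \<alpha>)"
proof -
  have "emeasure (exponent_measure \<alpha> \<nu>) {y \<in> E0. s < y $ j} =
      (\<integral>\<^sup>+ y. indicator {y \<in> E0. s < y $ j} y \<partial>exponent_measure \<alpha> \<nu>)"
    by (rule nn_integral_indicator[symmetric]) (simp add: sets_coord_gt sets_exponent)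
  also have "\<dots> = (\<integral>\<^sup>+ u. \<integral>\<^sup>+ r. indicator {y \<in> E0. s < y $ j} (r *\<^sub>R vec_powr u (1 / \<alpha>))
      \<partial>radial_measure \<alpha> \<partial>\<nu>)"
    by (intro nn_integral_exponent borel_measurable_indicator sets_coord_gt)
  also have "\<dots> = (\<integral>\<^sup>+ u. ennreal (s powr - \<alpha>) * ennreal (u $ j) \<partial>\<nu>)"
  proof (rule nn_integral_cong)
    fix u assume u: "u \<in> space \<nu>"
    define v where "v = u $ j powr (1 / \<alpha>)"
    have in_E0: "r *\<^sub>R vec_powr u (1 / \<alpha>) \<in> E0" if "0 < r" for r
      using measurable_space[OF measurable_polar, of "(r, u)"] that u
      by (simp add: space_pair_measure space_restrict_space)
    show "(\<integral>\<^sup>+ r. indicator {y \<in> E0. s < y $ j} (r *\<^sub>R vec_powr u (1 / \<alpha>)) \<partial>radial_measure \<alpha>) =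
        ennreal (s powr - \<alpha>) * ennreal (u $ j)"
    \<comment> \<open>For \<open>u $ j = 0\<close> the ray never reaches the half-space; division by
      \<open>v\<close> is confined to the other case.\<close>
    proof (cases "u $ j = 0")
      case True
      then have "(\<integral>\<^sup>+ r. indicator {y \<in> E0. s < y $ j} (r *\<^sub>R vec_powr u (1 / \<alpha>)) \<partial>radial_measure \<alpha>)
        = (\<integral>\<^sup>+ r. 0 \<partial>radial_measure \<alpha>)"
        using s by (intro nn_integral_cong) (auto simp: indicator_def)
      then show ?thesis using True by simp
    next
      case False
      then have u0: "0 < u $ j" using in_space_nuD(1)[OF u, of j] by simp
      then have v: "0 < v" by (simp add: v_def)
      have "(\<integral>\<^sup>+ r. indicator {y \<in> E0. s < y $ j} (r *\<^sub>R vec_powr u (1 / \<alpha>)) \<partial>radial_measure \<alpha>)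
        = (\<integral>\<^sup>+ r. indicator {s / v<..} r \<partial>radial_measure \<alpha>)"
        using v in_E0 by (intro nn_integral_cong) (auto simp: indicator_def v_def[symmetric] field_simps)
      also have "\<dots> = ennreal ((s / v) powr - \<alpha>)"
        using s v alpha_gt_1 by (intro nn_integral_radial_greaterThan) auto
      also have "(s / v) powr - \<alpha> = s powr - \<alpha> * (v powr \<alpha>)"
        using s v by (simp add: powr_divide powr_minus divide_simps)
      also have "v powr \<alpha> = u $ j"
        using u0 alpha_gt_1 by (simp add: v_def powr_powr)
      finally show ?thesis using u0 by (simp add: ennreal_mult)
    qed
  qed
  also have "\<dots> = ennreal (s powr - \<alpha>)"
    by (subst nn_integral_cmult) (auto intro!: borel_measurable_nu simp: nn_integral_nu_coord)
  finally show ?thesis .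
qed

text \<open>The complement of the box is a union of half-spaces, one for each coordinate:
  monotonicity gives the lower bound, subadditivity the upper one. Both tend to
  \<open>s powr - \<alpha>\<close> as \<open>c\<close> grows, which isolates the coordinate
  \<open>j\<close>.\<close>

lemma measure_exponent_outside_box:
  fixes j :: 'n
  assumes s: "0 < s" and c: "0 < c"
  defines "z \<equiv> (\<chi> i. if i = j then s else c)"
  shows "s powr - \<alpha> \<le> measure (exponent_measure \<alpha> \<nu>) (E0 - {0..z})"
    and "measure (exponent_measure \<alpha> \<nu>) (E0 - {0..z}) \<le> s powr - \<alpha> + real CARD('n) * c powr - \<alpha>"
proof -
  let ?\<mu> = "exponent_measure \<alpha> \<nu>"
  have zi: "0 < z $ i" for i using s c by (simp add: z_def)
  have eq: "E0 - {0..z} = (\<Union>i. {y \<in> E0. z $ i < y $ i})"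
    by (auto simp: E0_def orthant_def less_eq_vec_def; meson not_less)
  have meas: "{y \<in> E0. z $ i < y $ i} \<in> sets ?\<mu>" for i
    using sets_coord_gt sets_exponent by simp
  have sets: "E0 - {0..z} \<in> sets ?\<mu>" unfolding eq using meas by auto
  have "emeasure ?\<mu> (E0 - {0..z}) \<le> (\<Sum>i\<in>UNIV. emeasure ?\<mu> {y \<in> E0. z $ i < y $ i})"
    unfolding eq using meas by (intro emeasure_subadditive_finite) auto
  also have "\<dots> = (\<Sum>i\<in>UNIV. ennreal (z $ i powr - \<alpha>))"
    using emeasure_exponent_coord_gt[OF zi] by simp
  also have "\<dots> = ennreal (\<Sum>i\<in>UNIV. z $ i powr - \<alpha>)" by simp
  also have "\<dots> \<le> ennreal (s powr - \<alpha> + real CARD('n) * c powr - \<alpha>)"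
  proof (rule ennreal_leI)
    have "(\<Sum>i\<in>UNIV. z $ i powr - \<alpha>) \<le> (\<Sum>i\<in>UNIV. (if i = j then s powr - \<alpha> else 0) + c powr - \<alpha>)"
      by (rule sum_mono) (simp add: z_def)
    then show "(\<Sum>i\<in>UNIV. z $ i powr - \<alpha>) \<le> s powr - \<alpha> + real CARD('n) * c powr - \<alpha>"
      by (simp add: sum.distrib)
  qed
  finally have le: "emeasure ?\<mu> (E0 - {0..z}) \<le> ennreal (s powr - \<alpha> + real CARD('n) * c powr - \<alpha>)" .
  show "measure ?\<mu> (E0 - {0..z}) \<le> s powr - \<alpha> + real CARD('n) * c powr - \<alpha>"
    unfolding measure_def using enn2real_mono[OF le] by (simp del: ennreal_plus)
  have "ennreal (s powr - \<alpha>) \<le> emeasure ?\<mu> (E0 - {0..z})"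
    unfolding emeasure_exponent_coord_gt[OF s, of j, symmetric] using sets
    by (intro emeasure_mono) (auto simp: z_def less_eq_vec_def; metis leD)
  \<comment> \<open>The finite upper bound excludes the value 0 that \<open>measure\<close> takes on
    sets of infinite measure.\<close>
  then show "s powr - \<alpha> \<le> measure ?\<mu> (E0 - {0..z})"
    unfolding measure_def using order.strict_trans1[OF le ennreal_less_top]
      enn2real_mono[of "ennreal (s powr - \<alpha>)" "emeasure ?\<mu> (E0 - {0..z})"]
    by simp
qed

text \<open>Since the sphere lies in the unit cube, every coordinate on the ray of \<open>u\<close>
  is at most \<open>r\<close>. The sum is therefore at most d times a radial integrand of finite
  integral, and \<nu> is finite.\<close>

lemma integrable_exponent_bound:
  assumes f: "f \<in> borel_measurable (restrict_space borel E0)"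
    and le: "\<And>y. y \<in> E0 \<Longrightarrow> \<bar>f y\<bar> \<le> (\<Sum>j\<in>UNIV. y $ j * min \<alpha> (y $ j powr \<alpha>))"
  shows "integrable (exponent_measure \<alpha> \<nu>) f"
proof (rule integrableI_bounded)
  show "f \<in> borel_measurable (exponent_measure \<alpha> \<nu>)"
    using f by (simp add: measurable_cong_sets[OF sets_exponent refl])
  have "(\<integral>\<^sup>+ y. ennreal (norm (f y)) \<partial>exponent_measure \<alpha> \<nu>)
      = (\<integral>\<^sup>+ u. \<integral>\<^sup>+ r. ennreal (norm (f (r *\<^sub>R vec_powr u (1 / \<alpha>)))) \<partial>radial_measure \<alpha> \<partial>\<nu>)"
    using f by (intro nn_integral_exponent) auto
  also have "\<dots> \<le> (\<integral>\<^sup>+ u. \<integral>\<^sup>+ r. ennreal (real CARD('n)) * ennreal (r * min \<alpha> (r powr \<alpha>)) \<partial>radial_measure \<alpha> \<partial>\<nu>)"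
  proof (intro nn_integral_mono)
    fix u r assume u: "u \<in> space \<nu>" and "r \<in> space (radial_measure \<alpha>)"
    then have r: "0 < r" by simp
    have in_E0: "r *\<^sub>R vec_powr u (1 / \<alpha>) \<in> E0"
      using measurable_space[OF measurable_polar, of "(r, u)"] r u
      by (simp add: space_pair_measure space_restrict_space)
    have "\<bar>f (r *\<^sub>R vec_powr u (1 / \<alpha>))\<bar> \<le>
       (\<Sum>j\<in>UNIV. (r *\<^sub>R vec_powr u (1 / \<alpha>)) $ j * min \<alpha> ((r *\<^sub>R vec_powr u (1 / \<alpha>)) $ j powr \<alpha>))"
      by (rule le[OF in_E0])
    also have "\<dots> \<le> (\<Sum>j\<in>(UNIV::'n set). r * min \<alpha> (r powr \<alpha>))"
    proof (rule sum_mono)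
      fix j
      have "u $ j powr (1 / \<alpha>) \<le> 1"
        using in_space_nuD[OF u] alpha_gt_1 powr_mono2[of "1/\<alpha>" "u $ j" 1] by auto
      then have v: "(r *\<^sub>R vec_powr u (1 / \<alpha>)) $ j \<le> r" (is "?v \<le> r")
        using r mult_left_mono[of "u $ j powr (1 / \<alpha>)" 1 r] by simp
      have v0: "0 \<le> ?v" using r by simp
      show "?v * min \<alpha> (?v powr \<alpha>) \<le> r * min \<alpha> (r powr \<alpha>)"
        using v v0 r alpha_gt_1 powr_mono2[OF _ v0 v, of \<alpha>] by (intro mult_mono) auto
    qed
    finally have "\<bar>f (r *\<^sub>R vec_powr u (1 / \<alpha>))\<bar> \<le> real CARD('n) * (r * min \<alpha> (r powr \<alpha>))" by simp
    then show "ennreal (norm (f (r *\<^sub>R vec_powr u (1 / \<alpha>)))) \<le> ennreal (real CARD('n)) * ennreal (r * min \<alpha> (r powr \<alpha>))"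
      using r alpha_gt_1 by (simp add: ennreal_mult[symmetric] ennreal_leI)
  qed
  also have "\<dots> = ennreal (real CARD('n)) * (\<integral>\<^sup>+ r. ennreal (r * min \<alpha> (r powr \<alpha>)) \<partial>radial_measure \<alpha>)
      * emeasure \<nu> (space \<nu>)"
    by (subst nn_integral_cmult)
       (auto simp: measurable_cong_sets[OF sets_radial refl] intro!: measurable_restrict_space1)
  also have "\<dots> < \<infinity>"
    using nn_integral_radial_min_finite[OF alpha_gt_1] \<nu>.emeasure_finite[unfolded less_top infinity_ennreal_def]
    by (simp add: ennreal_mult_less_top)
  finally show "(\<integral>\<^sup>+ y. ennreal (norm (f y)) \<partial>exponent_measure \<alpha> \<nu>) < \<infinity>" .
qed

end

section \<open>Frechet marginals of the max-stable vector\<close>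

lemma exp_one_ge: "5 / 2 \<le> exp (1::real)"
  using exp_lower_Taylor_quadratic[of 1] by simp

text \<open>The exact maximum is \<open>4 * exp (- 2)\<close>, attained at \<open>u = 2\<close>. The
  inequality \<open>1 + x \<le> exp x\<close> at \<open>x = u / 2 - 1\<close> is tight there, and
  \<open>exp 1 \<ge> 5 / 2\<close> rounds the value up to 16/25.\<close>

lemma square_mult_exp_le:
  fixes u :: real
  assumes "0 \<le> u"
  shows "u\<^sup>2 * exp (- u) \<le> 16 / 25"
proof -
  have "5 / 4 * u \<le> exp 1 * (u / 2)" using mult_right_mono[OF exp_one_ge, of "u / 2"] assms by simp
  also have "\<dots> \<le> exp 1 * exp (u / 2 - 1)"
    using exp_ge_add_one_self[of "u / 2 - 1"] by (intro mult_left_mono) auto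
  also have "\<dots> = exp (u / 2)" by (simp flip: exp_add)
  finally have "(5 / 4 * u)\<^sup>2 \<le> (exp (u / 2))\<^sup>2" using assms by (intro power_mono) auto
  also have "(exp (u / 2))\<^sup>2 = exp u" by (simp flip: exp_double)
  finally show ?thesis by (simp add: exp_minus field_simps power2_eq_square)
qed

text \<open>With \<open>u = s powr - \<alpha>\<close> the left-hand side is \<alpha> times
  \<open>u * (1 / s) * exp (- u)\<close>. For \<open>s \<ge> 1\<close> the factor
  \<open>1 / s\<close> is dropped and \<open>u * exp (- u) \<le> 2 / 5\<close> suffices; for
  \<open>s < 1\<close> one has \<open>1 / s \<le> u\<close> because \<alpha> > 1, and
  \<open>square_mult_exp_le\<close> applies.\<close>

lemma frechet_density_bound:
  fixes \<alpha> s :: real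
  assumes "1 < \<alpha>" "0 < s"
  shows "\<alpha> * s powr (- \<alpha> - 1) * exp (- (s powr - \<alpha>)) \<le> 16 / 25 * \<alpha>"
proof -
  define u where "u = s powr - \<alpha>"
  have u: "0 < u" using assms by (simp add: u_def)
  have eq: "s powr (- \<alpha> - 1) = u * (1 / s)" using assms by (simp add: u_def powr_diff)
  have "u * (1 / s) * exp (- u) \<le> 16 / 25"
  proof (cases "1 \<le> s")
    case True
    have "u * (1 / s) * exp (- u) \<le> u * 1 * exp (- u)"
      using True u by (intro mult_right_mono mult_left_mono) auto
    also have "\<dots> \<le> 16 / 25"
    proof -
      have "5 / 2 * u \<le> exp 1 * exp (u - 1)"
        using exp_one_ge exp_ge_add_one_self[of "u - 1"] u by (intro mult_mono) auto
      also have "\<dots> = exp u" by (simp flip: exp_add)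
      finally show ?thesis using u by (simp add: exp_minus field_simps)
    qed
    finally show ?thesis .
  next
    case False
    have "1 / s = s powr - 1" using assms by (simp add: powr_minus field_simps)
    also have "\<dots> \<le> u" unfolding u_def
      using powr_mono_both[of 1 \<alpha> "1/s" "1/s"] assms False by (simp add: powr_divide powr_minus field_simps)
    finally have "1 / s \<le> u" .
    then have "u * (1 / s) * exp (- u) \<le> u * u * exp (- u)"
      using u by (intro mult_right_mono mult_left_mono) auto
    also have "\<dots> \<le> 16 / 25" using square_mult_exp_le[of u] u by (simp add: power2_eq_square)
    finally show ?thesis .
  qed
  then have "\<alpha> * (u * (1 / s) * exp (- u)) \<le> \<alpha> * (16 / 25)" using assms by (intro mult_left_mono) auto
  then show ?thesis unfolding eq u_def[symmetric] by (simp add: mult_ac)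
qed

lemma frechet_cdf_diff_le:
  fixes \<alpha> s t :: real
  assumes "1 < \<alpha>" "0 < s" "s \<le> t"
  shows "exp (- (t powr - \<alpha>)) - exp (- (s powr - \<alpha>)) \<le> 16 / 25 * \<alpha> * (t - s)"
proof (cases "s = t")
  case False
  then have "s < t" using assms by simp
  moreover have "DERIV (\<lambda>s. exp (- (s powr - \<alpha>))) x :> \<alpha> * x powr (- \<alpha> - 1) * exp (- (x powr - \<alpha>))"
    if "s \<le> x" "x \<le> t" for x
    using that assms by (auto intro!: derivative_eq_intros)
  ultimately obtain x where x: "s < x"
    "exp (- (t powr - \<alpha>)) - exp (- (s powr - \<alpha>)) = (t - s) * (\<alpha> * x powr (- \<alpha> - 1) * exp (- (x powr - \<alpha>)))"
    using MVT2[of s t "\<lambda>s. exp (- (s powr - \<alpha>))"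
        "\<lambda>x. \<alpha> * x powr (- \<alpha> - 1) * exp (- (x powr - \<alpha>))"] by blast
  have "(t - s) * (\<alpha> * x powr (- \<alpha> - 1) * exp (- (x powr - \<alpha>))) \<le> (t - s) * (16 / 25 * \<alpha>)"
    using frechet_density_bound[of \<alpha> x] x(1) assms by (intro mult_left_mono) auto
  then show ?thesis unfolding x(2) by (simp only: mult.commute)
qed simp

section \<open>The distribution of the coordinates of \<open>Z\<close>\<close>

locale max_stable_setting = angular_setting \<alpha> N \<nu> + prob_space M
  for \<alpha> :: real and N :: "real ^ 'n \<Rightarrow> real" and \<nu> :: "(real ^ 'n) measure" and M :: "'a measure" +
  fixes Z :: "'a \<Rightarrow> real ^ 'n"
  assumes max_stable: "max_stable_vector \<alpha> \<nu> M Z"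
begin

lemma measurable_Z_restrict: "Z \<in> M \<rightarrow>\<^sub>M restrict_space borel pos_orthant"
  using max_stable by (simp add: max_stable_vector_def)

lemma measurable_Z [measurable]: "Z \<in> borel_measurable M"
  using measurable_Z_restrict by (simp add: measurable_restrict_space2_iff)

lemma measurable_Z_nth [measurable]: "(\<lambda>\<omega>. Z \<omega> $ j) \<in> borel_measurable M"
  by (rule measurable_compose[OF measurable_Z]) simp

lemma Z_pos: "\<omega> \<in> space M \<Longrightarrow> 0 < Z \<omega> $ j"
  using measurable_space[OF measurable_Z_restrict] by (auto simp: space_restrict_space pos_orthant_def)

lemma prob_Z_le:
  assumes z: "z \<in> pos_orthant"
  shows "prob {\<omega> \<in> space M. Z \<omega> \<le> z} = exp (- measure (exponent_measure \<alpha> \<nu>) (E0 - {0..z}))"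
proof -
  let ?L = "distr M (restrict_space borel pos_orthant) Z"
  have "{x \<in> space ?L. x \<le> z} = pos_orthant \<inter> {..z}"
    by (auto simp: space_restrict_space)
  moreover have "pos_orthant \<inter> {..z} \<in> sets (restrict_space borel pos_orthant)"
    by (auto simp: sets_restrict_space closed_eucl_atMost intro!: imageI borel_closed)
  moreover have "Z -` (pos_orthant \<inter> {..z}) \<inter> space M = {\<omega> \<in> space M. Z \<omega> \<le> z}"
    using Z_pos by (auto simp: pos_orthant_def)
  ultimately have "measure ?L {x \<in> space ?L. x \<le> z} = prob {\<omega> \<in> space M. Z \<omega> \<le> z}"
    by (simp add: measure_distr measurable_Z_restrict)
  moreover have "measure ?L {x \<in> space ?L. x \<le> z} = exp (- measure (exponent_measure \<alpha> \<nu>) (E0 - {0..z}))"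
    using max_stable z unfolding max_stable_vector_def max_stable_law_def by blast
  ultimately show ?thesis by simp
qed

text \<open>The law of \<open>Z\<close> is prescribed on boxes with finite corners, so the other
  coordinates of the corner are sent to infinity. The bounds of
  \<open>measure_exponent_outside_box\<close> squeeze the probabilities, which also converge by
  continuity from below.\<close>

lemma prob_Z_nth_le:
  assumes s: "0 < s"
  shows "prob {\<omega> \<in> space M. Z \<omega> $ j \<le> s} = exp (- (s powr - \<alpha>))"
proof -
  \<comment> \<open>\<open>Suc n\<close> keeps the corner in the open orthant also for
    \<open>n = 0\<close>.\<close>
  define z :: "nat \<Rightarrow> real ^ 'n" where "z n = (\<chi> i. if i = j then s else real (Suc n))" for n
  define A where "A n = {\<omega> \<in> space M. Z \<omega> \<le> z n}" for n
  have z: "z n \<in> pos_orthant" for n using s by (simp add: z_def pos_orthant_def)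
  have "A n \<in> events" for n
  proof -
    have "A n = {\<omega> \<in> space M. \<forall>i. Z \<omega> $ i \<le> z n $ i}" by (simp add: A_def less_eq_vec_def)
    then show ?thesis by simp
  qed
  moreover have "incseq A"
  proof (rule incseq_SucI)
    have "z n \<le> z (Suc n)" for n by (simp add: z_def less_eq_vec_def)
    then show "A n \<le> A (Suc n)" for n unfolding A_def using order_trans by blast
  qed
  ultimately have "(\<lambda>n. prob (A n)) \<longlonglongrightarrow> prob (\<Union>n. A n)"
    by (intro finite_Lim_measure_incseq) auto
  also have "(\<Union>n. A n) = {\<omega> \<in> space M. Z \<omega> $ j \<le> s}"
  proof (intro equalityI subsetI)
    fix \<omega> assume "\<omega> \<in> {\<omega> \<in> space M. Z \<omega> $ j \<le> s}"
    then have \<omega>: "\<omega> \<in> space M" "Z \<omega> $ j \<le> s" by auto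
    obtain n where n: "Max (range (\<lambda>i. Z \<omega> $ i)) \<le> real n" using real_arch_simple by blast
    have "Z \<omega> $ i \<le> real n" for i
      using n Max_ge[of "range (\<lambda>i. Z \<omega> $ i)" "Z \<omega> $ i"] by auto
    then have "Z \<omega> $ i \<le> 1 + real n" for i by (meson le_add_same_cancel2 order_trans zero_le_one)
    then have "\<omega> \<in> A n" using \<omega> by (auto simp: A_def z_def less_eq_vec_def)
    then show "\<omega> \<in> (\<Union>n. A n)" by auto
  next
    fix \<omega> assume "\<omega> \<in> (\<Union>n. A n)"
    then obtain n where "\<omega> \<in> space M" "\<And>i. Z \<omega> $ i \<le> z n $ i" by (auto simp: A_def less_eq_vec_def)
    from this(1) this(2)[of j] show "\<omega> \<in> {\<omega> \<in> space M. Z \<omega> $ j \<le> s}" by (simp add: z_def)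
  qed
  finally have lim: "(\<lambda>n. prob (A n)) \<longlonglongrightarrow> prob {\<omega> \<in> space M. Z \<omega> $ j \<le> s}" .
  have "(\<lambda>n. prob (A n)) \<longlonglongrightarrow> exp (- (s powr - \<alpha>))"
  proof (rule tendsto_sandwich)
    have b: "s powr - \<alpha> \<le> measure (exponent_measure \<alpha> \<nu>) (E0 - {0..z n})"
      "measure (exponent_measure \<alpha> \<nu>) (E0 - {0..z n}) \<le> s powr - \<alpha> + real CARD('n) * real (Suc n) powr - \<alpha>" for n
      unfolding z_def using measure_exponent_outside_box[OF s, of "real (Suc n)" j] by auto
    show "\<forall>\<^sub>F n in sequentially. prob (A n) \<le> exp (- (s powr - \<alpha>))"
      using b(1) prob_Z_le[OF z] by (simp add: A_def)
    show "\<forall>\<^sub>F n in sequentially. exp (- (s powr - \<alpha> + real CARD('n) * real (Suc n) powr - \<alpha>)) \<le> prob (A n)"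
      unfolding A_def prob_Z_le[OF z] exp_le_cancel_iff neg_le_iff_le by (intro always_eventually allI b(2))
    have "(\<lambda>n. real (Suc n) powr - \<alpha>) \<longlonglongrightarrow> 0"
      using alpha_gt_1 by (intro tendsto_neg_powr filterlim_compose[OF filterlim_real_sequentially filterlim_Suc]) auto
    from tendsto_exp[OF tendsto_minus[OF tendsto_add[OF tendsto_const tendsto_mult_left[OF this]]]]
    show "(\<lambda>n. exp (- (s powr - \<alpha> + real CARD('n) * real (Suc n) powr - \<alpha>))) \<longlonglongrightarrow> exp (- (s powr - \<alpha>))"
      by (metis add.right_neutral mult_zero_right)
  qed auto
  then show ?thesis using lim LIMSEQ_unique by blast
qed

text \<open>By \<open>1 - exp (- x) \<le> x\<close>; this tail makes the coordinates
  integrable.\<close>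

lemma prob_Z_nth_gt_le:
  assumes "0 < s"
  shows "prob {\<omega> \<in> space M. s < Z \<omega> $ j} \<le> s powr - \<alpha>"
proof -
  have "{\<omega> \<in> space M. s < Z \<omega> $ j} = space M - {\<omega> \<in> space M. Z \<omega> $ j \<le> s}" by auto
  then have "prob {\<omega> \<in> space M. s < Z \<omega> $ j} = 1 - exp (- (s powr - \<alpha>))"
    using prob_Z_nth_le[OF assms, of j] by (simp add: prob_compl)
  then show ?thesis using exp_ge_add_one_self[of "- (s powr - \<alpha>)"] by simp
qed

text \<open>For \<open>s > 0\<close> this is the Lipschitz bound on the Frechet distribution
  function. At \<open>s = 0\<close> the convention \<open>0 powr - \<alpha> = 0\<close> gives the
  formula the value 1 instead of its limit 0, so this case is reached through lower ends
  \<open>e\<close> tending to 0 from the right.\<close>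

lemma prob_Z_nth_between:
  assumes "0 \<le> s" "s \<le> t"
  shows "prob {\<omega> \<in> space M. s < Z \<omega> $ j \<and> Z \<omega> $ j \<le> t} \<le> 16 / 25 * \<alpha> * (t - s)"
proof -
  have pos: "prob {\<omega> \<in> space M. s < Z \<omega> $ j \<and> Z \<omega> $ j \<le> t} \<le> 16 / 25 * \<alpha> * (t - s)"
    if "0 < s" "s \<le> t" for s
  proof -
    have "{\<omega> \<in> space M. s < Z \<omega> $ j \<and> Z \<omega> $ j \<le> t} =
        {\<omega> \<in> space M. Z \<omega> $ j \<le> t} - {\<omega> \<in> space M. Z \<omega> $ j \<le> s}" by auto
    then have "prob {\<omega> \<in> space M. s < Z \<omega> $ j \<and> Z \<omega> $ j \<le> t} = exp (- (t powr - \<alpha>)) - exp (- (s powr - \<alpha>))"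
      using that by (simp add: finite_measure_Diff prob_Z_nth_le Collect_mono)
    then show ?thesis using frechet_cdf_diff_le[OF alpha_gt_1 that] by simp
  qed
  show ?thesis
  proof (cases "0 < s \<or> t = 0")
    case True
    then show ?thesis
    proof
      assume "t = 0"
      then have "{\<omega> \<in> space M. s < Z \<omega> $ j \<and> Z \<omega> $ j \<le> t} = {}" using assms by auto
      then have "prob {\<omega> \<in> space M. s < Z \<omega> $ j \<and> Z \<omega> $ j \<le> t} = 0" by (simp only: measure_empty)
      then show ?thesis using assms alpha_gt_1 by simp
    qed (use pos assms in simp)
  next
    case False
    then have s: "s = 0" and t: "0 < t" using assms by auto
    have le: "prob {\<omega> \<in> space M. Z \<omega> $ j \<le> t} \<le> exp (- (e powr - \<alpha>)) + 16 / 25 * \<alpha> * (t - e)"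
      if "0 < e" "e \<le> t" for e
      using frechet_cdf_diff_le[OF alpha_gt_1 that] prob_Z_nth_le[OF t] by simp
    have "((\<lambda>e. exp (- (e powr - \<alpha>)) + 16 / 25 * \<alpha> * (t - e)) \<longlongrightarrow> 0 + 16 / 25 * \<alpha> * (t - 0)) (at_right 0)"
    proof (intro tendsto_intros)
      show "((\<lambda>e. exp (- (e powr - \<alpha>))) \<longlongrightarrow> 0) (at_right 0)"
      proof (rule tendsto_sandwich[where f = "\<lambda>_. 0"])
        \<comment> \<open>This is \<open>x \<le> exp x\<close> at
          \<open>x = e powr - \<alpha>\<close>, inverted.\<close>
        have "exp (- (e powr - \<alpha>)) \<le> e powr \<alpha>" if "0 < e" for e
        proof -
          have "inverse (e powr \<alpha>) \<le> exp (e powr - \<alpha>)"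
            unfolding powr_minus[symmetric] using exp_ge_add_one_self[of "e powr - \<alpha>"] by linarith
          then show ?thesis using that le_imp_inverse_le[of "inverse (e powr \<alpha>)"] by (simp add: exp_minus)
        qed
        then show "\<forall>\<^sub>F e in at_right 0. exp (- (e powr - \<alpha>)) \<le> e powr \<alpha>"
          using eventually_at_right_less[of "0::real"] by (auto elim: eventually_mono)
        show "((\<lambda>e. e powr \<alpha>) \<longlongrightarrow> 0) (at_right 0)"
          using alpha_gt_1 by (intro tendsto_zero_powrI tendsto_intros) (auto simp: eventually_at_right_less eventually_at_filter)
      qed auto
    qed
    moreover have "\<forall>\<^sub>F e in at_right 0. prob {\<omega> \<in> space M. Z \<omega> $ j \<le> t} \<le> exp (- (e powr - \<alpha>)) + 16 / 25 * \<alpha> * (t - e)"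
      unfolding eventually_at_right_field using t le by (meson less_imp_le)
    ultimately have "prob {\<omega> \<in> space M. Z \<omega> $ j \<le> t} \<le> 0 + 16 / 25 * \<alpha> * (t - 0)"
      by (intro tendsto_lowerbound) auto
    moreover have "prob {\<omega> \<in> space M. s < Z \<omega> $ j \<and> Z \<omega> $ j \<le> t} \<le> prob {\<omega> \<in> space M. Z \<omega> $ j \<le> t}"
      by (intro finite_measure_mono) auto
    ultimately show ?thesis using s by simp
  qed
qed

text \<open>The layer-cake formula: a positive number is the length of the interval from 0 to it, so
  Tonelli turns the mean into the integral of the tail probabilities. These are at most 1 up to
  \<open>s = 1\<close> and at most \<open>s powr - \<alpha>\<close> beyond, which is integrable as
  \<alpha> > 1.\<close>

lemma integrable_Z_nth: "integrable M (\<lambda>\<omega>. Z \<omega> $ j)"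
proof (rule integrableI_bounded)
  interpret P: pair_sigma_finite lborel M
    by standard
  have "(\<integral>\<^sup>+ \<omega>. ennreal (norm (Z \<omega> $ j)) \<partial>M) =
      (\<integral>\<^sup>+ \<omega>. \<integral>\<^sup>+ s. indicator {0..<Z \<omega> $ j} s \<partial>lborel \<partial>M)"
    using less_imp_le[OF Z_pos] by (intro nn_integral_cong) auto
  also have "\<dots> = (\<integral>\<^sup>+ \<omega>. \<integral>\<^sup>+ s. (if 0 \<le> s \<and> s < Z \<omega> $ j then 1 else 0) \<partial>lborel \<partial>M)"
    by (intro nn_integral_cong) (auto simp: indicator_def)
  also have "\<dots> = (\<integral>\<^sup>+ s. \<integral>\<^sup>+ \<omega>. (if 0 \<le> s \<and> s < Z \<omega> $ j then 1 else 0) \<partial>M \<partial>lborel)"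
    by (rule P.Fubini') measurable
  also have "\<dots> \<le> (\<integral>\<^sup>+ s. indicator {0..1} s +
      ennreal (1 / (\<alpha> - 1)) * (ennreal ((\<alpha> - 1) * s powr (- (\<alpha> - 1) - 1)) * indicator {1..} s) \<partial>lborel)"
  proof (rule nn_integral_mono)
    fix s :: real
    have eq: "(\<integral>\<^sup>+ \<omega>. (if 0 \<le> s \<and> s < Z \<omega> $ j then 1 else 0) \<partial>M) =
        (if 0 \<le> s then ennreal (prob {\<omega> \<in> space M. s < Z \<omega> $ j}) else 0)"
    proof -
      have "(\<integral>\<^sup>+ \<omega>. (if 0 \<le> s \<and> s < Z \<omega> $ j then 1 else 0) \<partial>M) =
          (\<integral>\<^sup>+ \<omega>. (if 0 \<le> s then 1 else 0) * indicator {\<omega> \<in> space M. s < Z \<omega> $ j} \<omega> \<partial>M)"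
        by (intro nn_integral_cong) (auto simp: indicator_def)
      then show ?thesis by (simp add: nn_integral_cmult emeasure_eq_measure)
    qed
    show "(\<integral>\<^sup>+ \<omega>. (if 0 \<le> s \<and> s < Z \<omega> $ j then 1 else 0) \<partial>M) \<le> indicator {0..1} s +
      ennreal (1 / (\<alpha> - 1)) * (ennreal ((\<alpha> - 1) * s powr (- (\<alpha> - 1) - 1)) * indicator {1..} s)"
    proof (cases "0 \<le> s \<and> s \<le> 1")
      case True
      then show ?thesis unfolding eq by (auto intro!: add_increasing2 simp: ennreal_le_1)
    next
      case False
      then show ?thesis unfolding eq using prob_Z_nth_gt_le[of s j] alpha_gt_1
        by (auto simp: ennreal_mult[symmetric] intro!: ennreal_leI)
    qed
  qed
  also have "\<dots> = 1 + ennreal (1 / (\<alpha> - 1))"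
    using alpha_gt_1 nn_integral_powr_atLeast[of "\<alpha> - 1" 1]
    by (subst nn_integral_add) (auto simp: nn_integral_cmult)
  also have "\<dots> < \<infinity>" by simp
  finally show "(\<integral>\<^sup>+ \<omega>. ennreal (norm (Z \<omega> $ j)) \<partial>M) < \<infinity>" .
qed measurable

end

section \<open>Integrals of the semi-group scales\<close>

lemma nn_integral_indicator_powr_0_1:
  fixes c :: real
  assumes "- 1 < c"
  shows "(\<integral>\<^sup>+ t. ennreal (indicator {0..1} t * t powr c) \<partial>lborel) < \<infinity>"
proof -
  have "((\<lambda>t. t powr c) has_integral (1 powr (c + 1) / (c + 1))) {0..1}"
    using assms by (intro has_integral_powr_from_0) auto
  from nn_integral_has_integral_lebesgue[OF _ this] show ?thesis
    by (simp add: indicator_mult_ennreal)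
qed

text \<open>The case \<open>c = \<alpha>\<close> yields the Lipschitz constant of the Stein
  solution, and \<open>c = s powr \<alpha>\<close> the bound that is small near the
  boundary.\<close>

lemma integrable_exp_scaled:
  fixes c :: real
  assumes "0 < c"
  shows "integrable (restrict_space lborel {0<..}) (\<lambda>t. exp (- t / c))"
    and "(\<integral>t. exp (- t / c) \<partial>restrict_space lborel {0<..}) = c"
  using integrable_I0i_exp_mscale[of "1 / c"] LBINT_I0i_exp_mscale[of "1 / c"] assms
  by (simp_all add: integrable_restrict_space integral_restrict_space set_integrable_def
      interval_lebesgue_integral_0_infty set_lebesgue_integral_def)

text \<open>Near 0, \<open>exp t - 1 \<ge> t\<close> reduces to
  \<open>t powr (- 1 / \<alpha>)\<close>, integrable because \<open>1 / \<alpha> < 1\<close>. Beyond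
  1, \<open>exp t - 1 \<ge> exp t / 2\<close> gives exponential decay with the constant
  \<open>2 powr (1 / \<alpha>) \<le> 2\<close>.\<close>

lemma integrable_exp_minus_1_powr:
  fixes \<alpha> :: real
  assumes "1 < \<alpha>"
  shows "integrable (restrict_space lborel {0<..}) (\<lambda>t. (exp t - 1) powr (- 1 / \<alpha>))"
proof -
  have "integrable lborel (\<lambda>t. indicator {0..1} t * t powr (- 1 / \<alpha>) :: real)"
    by (rule integrableI_bounded) (use assms nn_integral_indicator_powr_0_1[of "- 1 / \<alpha>"] in simp_all)
  moreover have "integrable lborel (\<lambda>t. indicator {0<..} t *\<^sub>R (2 * exp (- t / \<alpha>)))"
    using integrable_exp_scaled(1)[of \<alpha>] assms
    by (subst integrable_restrict_space[symmetric]) auto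
  ultimately have "integrable lborel
      (\<lambda>t. indicator {0..1} t * t powr (- 1 / \<alpha>) + indicator {0<..} t *\<^sub>R (2 * exp (- t / \<alpha>)))"
    by (rule Bochner_Integration.integrable_add)
  then have "integrable lborel (\<lambda>t. indicator {0<..} t *\<^sub>R (exp t - 1) powr (- 1 / \<alpha>))"
  proof (rule Bochner_Integration.integrable_bound)
    show "AE t in lborel. norm (indicator {0<..} t *\<^sub>R (exp t - 1) powr (- 1 / \<alpha>)) \<le>
        norm (indicator {0..1} t * t powr (- 1 / \<alpha>) + indicator {0<..} t *\<^sub>R (2 * exp (- t / \<alpha>)))"
    proof (rule AE_I2)
      fix t :: real
      have "(exp t - 1) powr (- 1 / \<alpha>) \<le> t powr (- 1 / \<alpha>)" if "0 < t"
      proof -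
        have "t \<le> exp t - 1" using exp_ge_add_one_self[of t] by linarith
        then show ?thesis using assms that by (intro powr_mono2') auto
      qed
      moreover have "(exp t - 1) powr (- 1 / \<alpha>) \<le> 2 * exp (- t / \<alpha>)" if "1 < t"
      proof -
        have "2 \<le> exp t" using that exp_ge_add_one_self[of t] by linarith
        then have "(exp t - 1) powr (- 1 / \<alpha>) \<le> (exp t / 2) powr (- 1 / \<alpha>)"
          using assms by (intro powr_mono2') auto
        also have "\<dots> = 2 powr (1 / \<alpha>) * exp (- t / \<alpha>)"
          by (simp add: powr_divide powr_minus exp_powr_real divide_simps exp_minus)
        also have "\<dots> \<le> 2 powr 1 * exp (- t / \<alpha>)"
          using assms by (intro mult_right_mono powr_mono) auto
        finally show ?thesis by simp
      qed
      ultimately show "norm (indicator {0<..} t *\<^sub>R (exp t - 1) powr (- 1 / \<alpha>)) \<le>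
        norm (indicator {0..1} t * t powr (- 1 / \<alpha>) + indicator {0<..} t *\<^sub>R (2 * exp (- t / \<alpha>)))"
        by (auto simp: indicator_def not_le add_increasing2)
    qed
  qed measurable
  then show ?thesis by (simp add: integrable_restrict_space)
qed

text \<open>\<open>a\<close> and \<open>b\<close> are the weights of \<open>x\<close> and
  \<open>Z\<close> in the semi-group, with \<open>a powr \<alpha> = exp (- t)\<close> and
  \<open>b powr \<alpha> = 1 - exp (- t)\<close>. The identity for
  \<open>(a / b) powr - \<alpha>\<close> is what enters the Frechet distribution function; the bound
  on \<open>a * b\<close> serves the second-order estimate.\<close>

lemma scale_bounds:
  fixes \<alpha> t :: real
  assumes "1 < \<alpha>" "0 < t"
  defines "a \<equiv> exp (- t / \<alpha>)" and "b \<equiv> (1 - exp (- t)) powr (1 / \<alpha>)"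
  shows "0 < a" "a \<le> 1" "0 < b" "b \<le> 1" "1 - b \<le> exp (- t)"
    and "a / b = (exp t - 1) powr (- 1 / \<alpha>)" and "(a / b) powr - \<alpha> = exp t - 1"
    and "a * b \<le> 3 / 10 * \<alpha>"
proof -
  show a: "0 < a" "a \<le> 1" using assms by (auto simp: a_def)
  have e: "0 < 1 - exp (- t)" "1 - exp (- t) \<le> 1" using assms by auto
  show b: "0 < b" using e by (simp add: b_def)
  show "b \<le> 1" using powr_mono2[of "1 / \<alpha>" "1 - exp (- t)" 1] e assms by (simp add: b_def)
  \<comment> \<open>The base lies in [0, 1] and \<open>1 / \<alpha> \<le> 1\<close>, so lowering the
    exponent can only increase the power.\<close>
  have "(1 - exp (- t)) powr 1 \<le> b" unfolding b_def using e assms by (intro powr_mono') auto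
  then show "1 - b \<le> exp (- t)" using e by simp
  have a_eq: "a = exp (- t) powr (1 / \<alpha>)" by (simp add: a_def exp_powr_real)
  have "a / b = (exp (- t) / (1 - exp (- t))) powr (1 / \<alpha>)"
    using e by (simp add: a_eq b_def powr_divide)
  also have "exp (- t) / (1 - exp (- t)) = inverse (exp t - 1)"
    using e assms by (simp add: exp_minus field_simps)
  also have "\<dots> powr (1 / \<alpha>) = (exp t - 1) powr (- 1 / \<alpha>)"
    using assms by (simp add: powr_minus inverse_powr)
  finally show eq: "a / b = (exp t - 1) powr (- 1 / \<alpha>)" .
  show "(a / b) powr - \<alpha> = exp t - 1" unfolding eq using assms by (simp add: powr_powr)
  have "a * b = (exp (- t) * (1 - exp (- t))) powr (1 / \<alpha>)"
    using e by (simp add: a_eq b_def powr_mult)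
  also have "\<dots> \<le> (1 / 4) powr (1 / \<alpha>)"
  proof (rule powr_mono2)
    show "exp (- t) * (1 - exp (- t)) \<le> 1 / 4"
      using zero_le_power2[of "exp (- t) - 1 / 2"] by (simp add: power2_eq_square algebra_simps)
  qed (use e assms in auto)
  also have "\<dots> = exp (- (2 * ln 2 / \<alpha>))"
    using ln_realpow[of 2 2] by (simp add: powr_def ln_div)
  \<comment> \<open>With \<open>y = 2 * ln 2 / \<alpha>\<close> one has
    \<open>exp y \<ge> exp 1 * y \<ge> 5 / 2 * y\<close>, and \<open>ln 2 \<ge> 2 / 3\<close> gives
    \<open>y \<ge> 4 / (3 * \<alpha>)\<close>; the reciprocal of the product is 3/10 times
    \<alpha>.\<close>
  also have "\<dots> \<le> 3 / 10 * \<alpha>"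
  proof -
    define y where "y = 2 * ln 2 / \<alpha>"
    have y: "4 / (3 * \<alpha>) \<le> y"
      unfolding y_def using assms ln2_ge_two_thirds by (simp add: field_simps)
    then have y0: "0 < y" using assms by (meson divide_pos_pos less_le_trans mult_pos_pos order_less_trans zero_less_numeral zero_less_one)
    have "5 / 2 * y \<le> exp 1 * exp (y - 1)"
      using exp_one_ge exp_ge_add_one_self[of "y - 1"] y0 by (intro mult_mono) auto
    also have "\<dots> = exp y" by (simp flip: exp_add)
    finally have "5 / 2 * (4 / (3 * \<alpha>)) \<le> exp y" using y by linarith
    then show ?thesis unfolding y_def[symmetric] using assms by (simp add: exp_minus field_simps)
  qed
  finally show "a * b \<le> 3 / 10 * \<alpha>" .
qed

text \<open>
  With \<open>w = a / b\<close> one has \<open>a\<^sup>2 = w (a b) \<le> 3/10 \<alpha> w\<close>, and \<open>3/10 + 16/25 < 1\<close>.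
\<close>

lemma scales_C2_bound:
  fixes \<alpha> t :: real
  assumes "1 < \<alpha>" "0 < t"
  shows "(exp (- t / \<alpha>))\<^sup>2 + 16 / 25 * \<alpha> * exp (- t / \<alpha>) * (exp t - 1) powr (- 1 / \<alpha>)
    \<le> \<alpha> * (exp t - 1) powr (- 1 / \<alpha>)"
proof -
  define a b w where "a = exp (- t / \<alpha>)" and "b = (1 - exp (- t)) powr (1 / \<alpha>)"
    and "w = (exp t - 1) powr (- 1 / \<alpha>)"
  note sc = scale_bounds[OF assms, folded a_def b_def w_def]
  have w: "0 \<le> w" by (simp add: w_def)
  have "a = w * b" using sc(3) sc(6) by (simp add: field_simps)
  then have "a\<^sup>2 = w * (a * b)" by (simp add: power2_eq_square)
  also have "\<dots> \<le> w * (3 / 10 * \<alpha>)" using sc(8) w by (intro mult_left_mono)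
  finally have 1: "a\<^sup>2 \<le> w * (3 / 10 * \<alpha>)" .
  have "16 / 25 * \<alpha> * a * w \<le> 16 / 25 * \<alpha> * 1 * w"
    using sc(2) w assms by (intro mult_right_mono mult_left_mono) auto
  with 1 have "a\<^sup>2 + 16 / 25 * \<alpha> * a * w \<le> 94 / 100 * (\<alpha> * w)" by (simp add: field_simps)
  also have "\<dots> \<le> \<alpha> * w" using w assms by (simp add: mult_left_le_one_le)
  finally show ?thesis unfolding a_def w_def .
qed

section \<open>The Stein solution as an integral over a product space\<close>

lemma norm1_nonneg: "0 \<le> norm1 x"
  by (simp add: norm1_def sum_nonneg)

lemma abs_nth_le_norm1: "\<bar>x $ j\<bar> \<le> norm1 x"
  unfolding norm1_def by (rule member_le_sum) auto

lemma norm1_le_norm: "norm1 x \<le> real CARD('n) * norm (x :: real ^ 'n)"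
  unfolding norm1_def using sum_bounded_above[of UNIV "\<lambda>j. \<bar>x $ j\<bar>" "norm x"] component_le_norm_cart by blast

lemma norm1_upd: "norm1 (upd x j s - upd x j t) = \<bar>s - t\<bar>"
proof -
  have "norm1 (upd x j s - upd x j t) = (\<Sum>i\<in>UNIV. if i = j then \<bar>s - t\<bar> else 0)"
    unfolding norm1_def by (intro sum.cong) (auto simp: upd_def)
  then show ?thesis by simp
qed

lemma upd_self [simp]: "upd x j (x $ j) = x"
  by (simp add: upd_def vec_eq_iff)

lemma upd_in_orthant: "x \<in> orthant \<Longrightarrow> 0 \<le> s \<Longrightarrow> upd x j s \<in> orthant"
  by (simp add: orthant_iff upd_def)

lemma lipschitz1_continuous_on:
  assumes "lipschitz1 C f"
  shows "continuous_on orthant (f :: real ^ 'n \<Rightarrow> real)"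
proof (rule continuous_onI)
  fix x :: "real ^ 'n" and e :: real assume x: "x \<in> orthant" and e: "0 < e"
  \<comment> \<open>The summand 1 keeps \<open>K\<close> positive when \<open>C = 0\<close>.\<close>
  define K where "K = \<bar>C\<bar> * real CARD('n) + 1"
  have K: "0 < K" by (auto simp: K_def intro: add_nonneg_pos)
  show "\<exists>d>0. \<forall>y\<in>orthant. dist y x < d \<longrightarrow> dist (f y) (f x) \<le> e"
  proof (intro exI[of _ "e / K"] conjI ballI impI)
    fix y assume y: "y \<in> orthant" "dist y x < e / K"
    have "\<bar>f y - f x\<bar> \<le> C * norm1 (y - x)" using assms x y by (simp add: lipschitz1_def)
    also have "\<dots> \<le> \<bar>C\<bar> * (real CARD('n) * norm (y - x))"
      using norm1_le_norm[of "y - x"] norm1_nonneg by (intro mult_mono) auto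
    also have "\<dots> \<le> K * norm (y - x)" by (simp add: K_def algebra_simps)
    also have "\<dots> \<le> e" using y K by (simp add: dist_norm field_simps)
    finally show "dist (f y) (f x) \<le> e" by (simp add: dist_real_def)
  qed (use e K in simp)
qed

text \<open>At 0 this filter is one-sided; its being nontrivial makes the partial derivatives unique
  on the boundary as well and lets bounds on difference quotients pass to the limit.\<close>

lemma at_within_nonneg_neq_bot:
  fixes x :: real
  assumes "0 \<le> x"
  shows "at x within {0..} \<noteq> bot"
proof -
  have "at_right x \<le> at x within {0..}" using assms by (intro at_le) auto
  then show ?thesis using trivial_limit_at_right_real[of x] by (metis bot.extremum_uniqueI)
qed

lemma partial_eqI:
  assumes "x \<in> orthant" "((\<lambda>s. f (upd x j s)) has_real_derivative D) (at (x $ j) within {0..})"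
  shows "partial_diff j f x" "partial j f x = D"
proof -
  have *: "((\<lambda>s. f (upd x j s)) has_vector_derivative D) (at (x $ j) within {0..})"
    using assms(2) by (simp add: has_real_derivative_iff_has_vector_derivative)
  then show "partial_diff j f x" unfolding partial_diff_def by (rule differentiableI_vector)
  show "partial j f x = D" unfolding partial_def
    using assms(1) * by (intro vector_derivative_within at_within_nonneg_neq_bot) (auto simp: orthant_iff)
qed

lemma partial_works:
  assumes "partial_diff j f x"
  shows "((\<lambda>s. f (upd x j s)) has_real_derivative partial j f x) (at (x $ j) within {0..})"
  using assms unfolding partial_diff_def partial_def has_real_derivative_iff_has_vector_derivative
  by (simp add: vector_derivative_works[symmetric])

lemma abs_partial_le:
  assumes lip: "lipschitz1 C f" and diff: "partial_diff j f x" and x: "x \<in> orthant"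
  shows "\<bar>partial j f x\<bar> \<le> C"
proof -
  have "((\<lambda>s. (f (upd x j s) - f (upd x j (x $ j))) / (s - x $ j)) \<longlongrightarrow> partial j f x) (at (x $ j) within {0..})"
    using partial_works[OF diff] by (simp only: has_field_derivative_iff)
  moreover have "\<forall>\<^sub>F s in at (x $ j) within {0..}.
      \<bar>(f (upd x j s) - f (upd x j (x $ j))) / (s - x $ j)\<bar> \<le> C"
    unfolding eventually_at_filter
  proof (intro always_eventually allI impI)
    fix s assume s: "s \<noteq> x $ j" "s \<in> {0..}"
    have "\<bar>f (upd x j s) - f (upd x j (x $ j))\<bar> \<le> C * \<bar>s - x $ j\<bar>"
      using lip upd_in_orthant[OF x, of s j] x s by (metis atLeast_iff lipschitz1_def norm1_upd upd_self)
    then show "\<bar>(f (upd x j s) - f (upd x j (x $ j))) / (s - x $ j)\<bar> \<le> C"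
      using s by (simp add: divide_le_eq)
  qed
  ultimately show ?thesis
    using x at_within_nonneg_neq_bot[of "x $ j"]
    by (intro tendsto_upperbound[OF tendsto_rabs]) (auto simp: orthant_iff)
qed

lemma norm_integral_le_integral:
  fixes f :: "'b \<Rightarrow> 'c::{banach, second_countable_topology}"
  assumes "integrable M f" "integrable M g" "\<And>x. x \<in> space M \<Longrightarrow> norm (f x) \<le> g x"
  shows "norm (integral\<^sup>L M f) \<le> integral\<^sup>L M g"
  by (rule order_trans[OF integral_norm_bound integral_mono[OF integrable_norm[OF assms(1)] assms(2,3)]])

context max_stable_setting
begin

section \<open>The flow and its integrability over time and chance\<close>

abbreviation T :: "real measure" where "T \<equiv> restrict_space lborel {0<..}"

sublocale Q: pair_sigma_finite T M
  unfolding pair_sigma_finite_def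
  by (simp add: sigma_finite_measure_restrict_space lborel.sigma_finite_measure_axioms sigma_finite_measure_axioms)

lemma space_T: "space T = {0<..}"
  by (simp add: space_restrict_space)

lemma measurable_T: "f \<in> borel_measurable borel \<Longrightarrow> f \<in> borel_measurable T"
  by (rule measurable_restrict_space1) simp

text \<open>The argument of \<open>h\<close> inside the expectation of the semi-group. Keeping
  \<omega> explicit allows all estimates to be made pointwise before integrating over time and
  chance together.\<close>

definition flow :: "real \<Rightarrow> 'a \<Rightarrow> real ^ 'n \<Rightarrow> real ^ 'n" where
  "flow t \<omega> x = sup (exp (- t / \<alpha>) *\<^sub>R x) ((1 - exp (- t)) powr (1 / \<alpha>) *\<^sub>R Z \<omega>)"

lemma flow_nth: "flow t \<omega> x $ j = max (exp (- t / \<alpha>) * x $ j) ((1 - exp (- t)) powr (1 / \<alpha>) * Z \<omega> $ j)"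
  by (simp add: flow_def)

lemma flow_in_orthant: "x \<in> orthant \<Longrightarrow> flow t \<omega> x \<in> orthant"
  by (simp add: orthant_iff flow_nth le_max_iff_disj)

lemma Z_in_orthant: "\<omega> \<in> space M \<Longrightarrow> Z \<omega> \<in> orthant"
  using Z_pos by (simp add: orthant_iff less_imp_le)

lemma measurable_fst_Q [measurable]: "fst \<in> borel_measurable (T \<Otimes>\<^sub>M M)"
  by (rule measurable_compose[OF measurable_fst measurable_T]) simp

lemma measurable_flow: "(\<lambda>(t, \<omega>). flow t \<omega> x) \<in> borel_measurable (T \<Otimes>\<^sub>M M)"
proof (subst borel_measurable_euclidean_space, rule ballI)
  fix i :: "real ^ 'n" assume "i \<in> Basis"
  then obtain j where i: "i = axis j 1" by (auto simp: Basis_vec_def)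
  have [measurable]: "(\<lambda>p. Z (snd p) $ j) \<in> borel_measurable (T \<Otimes>\<^sub>M M)"
    by (rule measurable_compose[OF measurable_snd measurable_Z_nth])
  show "(\<lambda>p. (case p of (t, \<omega>) \<Rightarrow> flow t \<omega> x) \<bullet> i) \<in> borel_measurable (T \<Otimes>\<^sub>M M)"
    by (simp add: i inner_axis split_beta flow_nth)
qed

lemma measurable_flow_compose:
  assumes "continuous_on orthant k" "x \<in> orthant"
  shows "(\<lambda>(t, \<omega>). k (flow t \<omega> x)) \<in> borel_measurable (T \<Otimes>\<^sub>M M)"
proof -
  have "(\<lambda>(t, \<omega>). flow t \<omega> x) \<in> T \<Otimes>\<^sub>M M \<rightarrow>\<^sub>M restrict_space borel orthant"
    using flow_in_orthant[OF assms(2)] by (intro measurable_restrict_space2 measurable_flow) auto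
  from measurable_compose[OF this borel_measurable_continuous_on_restrict[OF assms(1)]]
  show ?thesis by (simp add: split_beta)
qed

lemma measurable_Z_compose:
  assumes "continuous_on orthant k"
  shows "(\<lambda>\<omega>. k (Z \<omega>)) \<in> borel_measurable M"
proof -
  have "Z \<in> M \<rightarrow>\<^sub>M restrict_space borel orthant"
    using Z_in_orthant by (intro measurable_restrict_space2 measurable_Z) auto
  from measurable_compose[OF this borel_measurable_continuous_on_restrict[OF assms]] show ?thesis .
qed

lemma integrable_Q_mult:
  fixes f :: "real \<Rightarrow> real" and g :: "'a \<Rightarrow> real"
  assumes f: "integrable T f" and g: "integrable M g"
  shows "integrable (T \<Otimes>\<^sub>M M) (\<lambda>(t, \<omega>). f t * g \<omega>)"
proof (rule Q.Fubini_integrable)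
  have "f \<in> borel_measurable T" "g \<in> borel_measurable M" using f g by auto
  then show "(\<lambda>(t, \<omega>). f t * g \<omega>) \<in> borel_measurable (T \<Otimes>\<^sub>M M)" by measurable
  show "integrable T (\<lambda>t. \<integral>\<omega>. norm (case (t, \<omega>) of (t, \<omega>) \<Rightarrow> f t * g \<omega>) \<partial>M)"
    using f by (simp add: abs_mult)
qed (use g in simp)

lemma integrable_Q_const:
  fixes f :: "real \<Rightarrow> real"
  assumes f: "integrable T f"
  shows "integrable (T \<Otimes>\<^sub>M M) (\<lambda>(t, \<omega>). f t)"
    and "(\<integral>(t, \<omega>). f t \<partial>(T \<Otimes>\<^sub>M M)) = (\<integral>t. f t \<partial>T)"
proof -
  show *: "integrable (T \<Otimes>\<^sub>M M) (\<lambda>(t, \<omega>). f t)"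
    using integrable_Q_mult[OF f, of "\<lambda>_. 1"] by simp
  show "(\<integral>(t, \<omega>). f t \<partial>(T \<Otimes>\<^sub>M M)) = (\<integral>t. f t \<partial>T)"
    using Q.integral_fst[OF *] by (simp add: prob_space)
qed

lemma integrable_Q_exp:
  shows "integrable (T \<Otimes>\<^sub>M M) (\<lambda>(t, \<omega>). exp (- t / \<alpha>))"
    and "(\<integral>(t, \<omega>). exp (- t / \<alpha>) \<partial>(T \<Otimes>\<^sub>M M)) = \<alpha>"
  using integrable_Q_const[OF integrable_exp_scaled(1)] integrable_exp_scaled(2)[of \<alpha>] alpha_gt_1 by simp_all

text \<open>Taking the maximum with a fixed number is 1-Lipschitz, so each coordinate contracts by
  the factor in front of \<open>x\<close>.\<close>

lemma norm1_flow_diff_le: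
  "norm1 (flow t \<omega> x - flow t \<omega> y) \<le> exp (- t / \<alpha>) * norm1 (x - y)"
  unfolding norm1_def sum_distrib_left
proof (rule sum_mono)
  fix j
  have "\<bar>max (a * u) b - max (a * v) b\<bar> \<le> a * \<bar>u - v\<bar>" if "0 \<le> a" for a b u v :: real
  proof -
    have "\<bar>max (a * u) b - max (a * v) b\<bar> \<le> \<bar>a * u - a * v\<bar>" by (auto simp: max_def abs_if)
    also have "\<dots> = a * \<bar>u - v\<bar>" using that by (simp flip: right_diff_distrib add: abs_mult)
    finally show ?thesis .
  qed
  then show "\<bar>(flow t \<omega> x - flow t \<omega> y) $ j\<bar> \<le> exp (- t / \<alpha>) * \<bar>(x - y) $ j\<bar>"
    by (simp add: flow_nth)
qed

text \<open>In each coordinate the difference lies between \<open>- (1 - b) * Z\<close> and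
  \<open>a * x\<close>, and \<open>1 - b \<le> exp (- t)\<close>. Both time factors are integrable
  on the half-line, which makes the Stein integral converge.\<close>

lemma norm1_flow_minus_Z_le:
  assumes t: "0 < t" and \<omega>: "\<omega> \<in> space M" and x: "x \<in> orthant"
  shows "norm1 (flow t \<omega> x - Z \<omega>) \<le> exp (- t / \<alpha>) * norm1 x + exp (- t) * norm1 (Z \<omega>)"
  unfolding norm1_def sum_distrib_left sum.distrib[symmetric]
proof (rule sum_mono)
  fix j
  define a b where "a = exp (- t / \<alpha>)" and "b = (1 - exp (- t)) powr (1 / \<alpha>)"
  note sc = scale_bounds[OF alpha_gt_1 t, folded a_def b_def]
  have z: "0 < Z \<omega> $ j" using Z_pos[OF \<omega>] .
  have "b * Z \<omega> $ j \<le> Z \<omega> $ j" using sc(4) z by simp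
  moreover have "Z \<omega> $ j - b * Z \<omega> $ j \<le> exp (- t) * Z \<omega> $ j"
    using mult_right_mono[OF sc(5), of "Z \<omega> $ j"] z by (simp add: algebra_simps)
  moreover have "0 \<le> a * x $ j" using x sc(1) by (simp add: orthant_iff)
  ultimately have "\<bar>max (a * x $ j) (b * Z \<omega> $ j) - Z \<omega> $ j\<bar> \<le> a * x $ j + exp (- t) * Z \<omega> $ j"
    using z mult_pos_pos[OF exp_gt_zero[of "- t"] z] unfolding max_def abs_if by argo
  moreover have "0 \<le> x $ j" using x by (simp add: orthant_iff)
  ultimately show "\<bar>(flow t \<omega> x - Z \<omega>) $ j\<bar> \<le> exp (- t / \<alpha>) * \<bar>x $ j\<bar> + exp (- t) * \<bar>Z \<omega> $ j\<bar>"
    using z by (simp add: flow_nth a_def b_def)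
qed

lemma integrable_norm1_Z: "integrable M (\<lambda>\<omega>. norm1 (Z \<omega>))"
  unfolding norm1_def by (intro Bochner_Integration.integrable_sum integrable_abs integrable_Z_nth)

context
  fixes h :: "real ^ 'n \<Rightarrow> real"
  assumes lip: "lipschitz1 1 h"
begin

lemma integrable_h_Z: "integrable M (\<lambda>\<omega>. h (Z \<omega>))"
proof (rule Bochner_Integration.integrable_bound)
  show "integrable M (\<lambda>\<omega>. \<bar>h 0\<bar> + norm1 (Z \<omega>))"
    using integrable_norm1_Z by simp
  show "AE \<omega> in M. norm (h (Z \<omega>)) \<le> norm (\<bar>h 0\<bar> + norm1 (Z \<omega>))"
  proof (rule AE_I2)
    fix \<omega> assume "\<omega> \<in> space M"
    then have "\<bar>h (Z \<omega>) - h 0\<bar> \<le> 1 * norm1 (Z \<omega> - 0)"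
      using lip Z_in_orthant unfolding lipschitz1_def by (metis orthant_iff order_refl zero_index)
    then show "norm (h (Z \<omega>)) \<le> norm (\<bar>h 0\<bar> + norm1 (Z \<omega>))" by simp
  qed
qed (rule measurable_Z_compose[OF lipschitz1_continuous_on[OF lip]])

lemma integrable_flow_minus_Z:
  assumes x: "x \<in> orthant"
  shows "integrable (T \<Otimes>\<^sub>M M) (\<lambda>(t, \<omega>). h (flow t \<omega> x) - h (Z \<omega>))"
proof (rule Bochner_Integration.integrable_bound)
  note cont = lipschitz1_continuous_on[OF lip]
  have "(\<lambda>p. h (Z (snd p))) \<in> borel_measurable (T \<Otimes>\<^sub>M M)"
    by (rule measurable_compose[OF measurable_snd measurable_Z_compose[OF cont]])
  then show "(\<lambda>(t, \<omega>). h (flow t \<omega> x) - h (Z \<omega>)) \<in> borel_measurable (T \<Otimes>\<^sub>M M)"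
    using measurable_flow_compose[OF cont x] unfolding split_beta by (rule borel_measurable_diff[rotated])
  have "integrable (T \<Otimes>\<^sub>M M) (\<lambda>(t, \<omega>). exp (- t / \<alpha>) * norm1 x)"
    using alpha_gt_1 by (intro integrable_Q_mult integrable_exp_scaled) auto
  moreover have "integrable (T \<Otimes>\<^sub>M M) (\<lambda>(t, \<omega>). exp (- t) * norm1 (Z \<omega>))"
    using integrable_exp_scaled(1)[of 1] by (intro integrable_Q_mult integrable_norm1_Z) auto
  ultimately show "integrable (T \<Otimes>\<^sub>M M)
      (\<lambda>p. (\<lambda>(t, \<omega>). exp (- t / \<alpha>) * norm1 x) p + (\<lambda>(t, \<omega>). exp (- t) * norm1 (Z \<omega>)) p)"
    by (rule Bochner_Integration.integrable_add)
  show "AE p in T \<Otimes>\<^sub>M M. norm (case p of (t, \<omega>) \<Rightarrow> h (flow t \<omega> x) - h (Z \<omega>)) \<le>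
      norm ((\<lambda>(t, \<omega>). exp (- t / \<alpha>) * norm1 x) p + (\<lambda>(t, \<omega>). exp (- t) * norm1 (Z \<omega>)) p)"
  proof (rule AE_I2)
    fix p assume "p \<in> space (T \<Otimes>\<^sub>M M)"
    then obtain t \<omega> where p: "p = (t, \<omega>)" "0 < t" "\<omega> \<in> space M"
      by (auto simp: space_pair_measure space_T)
    have "\<bar>h (flow t \<omega> x) - h (Z \<omega>)\<bar> \<le> 1 * norm1 (flow t \<omega> x - Z \<omega>)"
      using lip flow_in_orthant[OF x] Z_in_orthant[OF p(3)] unfolding lipschitz1_def by blast
    also have "\<dots> \<le> exp (- t / \<alpha>) * norm1 x + exp (- t) * norm1 (Z \<omega>)"
      using norm1_flow_minus_Z_le[OF p(2,3) x] by simp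
    finally show "norm (case p of (t, \<omega>) \<Rightarrow> h (flow t \<omega> x) - h (Z \<omega>)) \<le>
      norm ((\<lambda>(t, \<omega>). exp (- t / \<alpha>) * norm1 x) p + (\<lambda>(t, \<omega>). exp (- t) * norm1 (Z \<omega>)) p)"
      by (simp add: p)
  qed
qed

text \<open>Fubini. For almost every \<open>t\<close> the section is integrable in \<omega>; adding
  the integrable \<open>h (Z \<omega>)\<close> makes \<open>h (flow t \<omega> x)\<close> integrable
  too, so the inner integral of the difference splits.\<close>

lemma stein_solution_eq:
  assumes x: "x \<in> orthant"
  shows "stein_solution \<alpha> M Z h x = - (\<integral>(t, \<omega>). h (flow t \<omega> x) - h (Z \<omega>) \<partial>(T \<Otimes>\<^sub>M M))"
proof -
  note int = integrable_flow_minus_Z[OF x]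
  have "(\<integral>(t, \<omega>). h (flow t \<omega> x) - h (Z \<omega>) \<partial>(T \<Otimes>\<^sub>M M)) = (\<integral>t. \<integral>\<omega>. h (flow t \<omega> x) - h (Z \<omega>) \<partial>M \<partial>T)"
    using Q.integral_fst[OF int] by simp
  also have "\<dots> = (\<integral>t. ms_semigroup \<alpha> M Z t h x - (\<integral>\<omega>. h (Z \<omega>) \<partial>M) \<partial>T)"
  proof (rule integral_cong_AE)
    show "AE t in T. (\<integral>\<omega>. h (flow t \<omega> x) - h (Z \<omega>) \<partial>M) = ms_semigroup \<alpha> M Z t h x - (\<integral>\<omega>. h (Z \<omega>) \<partial>M)"
      using Q.AE_integrable_fst'[OF int]
    proof eventually_elim
      case (elim t)
      then have "integrable M (\<lambda>\<omega>. h (flow t \<omega> x) - h (Z \<omega>))" by simp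
      from Bochner_Integration.integrable_add[OF this integrable_h_Z]
      have "integrable M (\<lambda>\<omega>. h (flow t \<omega> x))" by simp
      then show ?case using integrable_h_Z by (simp add: ms_semigroup_def flow_def)
    qed
    have "(\<lambda>t. \<integral>\<omega>. h (flow t \<omega> x) \<partial>M) \<in> borel_measurable T"
      by (intro borel_measurable_lebesgue_integral measurable_flow_compose lipschitz1_continuous_on[OF lip] x)
    then show "(\<lambda>t. ms_semigroup \<alpha> M Z t h x - (\<integral>\<omega>. h (Z \<omega>) \<partial>M)) \<in> borel_measurable T"
      by (simp add: ms_semigroup_def flow_def)
    show "(\<lambda>t. \<integral>\<omega>. h (flow t \<omega> x) - h (Z \<omega>) \<partial>M) \<in> borel_measurable T"
      using int by (intro borel_measurable_lebesgue_integral) auto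
  qed
  also have "\<dots> = (LINT t:{0<..}|lborel. ms_semigroup \<alpha> M Z t h x - (\<integral>\<omega>. h (Z \<omega>) \<partial>M))"
    by (simp add: integral_restrict_space set_lebesgue_integral_def)
  finally show ?thesis by (simp add: stein_solution_def)
qed

lemma integrable_flow_diff:
  assumes "x \<in> orthant" "y \<in> orthant"
  shows "integrable (T \<Otimes>\<^sub>M M) (\<lambda>(t, \<omega>). h (flow t \<omega> x) - h (flow t \<omega> y))"
  using Bochner_Integration.integrable_diff[OF integrable_flow_minus_Z[OF assms(1)] integrable_flow_minus_Z[OF assms(2)]]
  by (simp add: case_prod_unfold)

text \<open>The centring term \<open>h (Z \<omega>)\<close> cancels, so increments of the Stein
  solution are governed by increments of the flow alone.\<close>

lemma stein_solution_diff:
  assumes "x \<in> orthant" "y \<in> orthant"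
  shows "stein_solution \<alpha> M Z h x - stein_solution \<alpha> M Z h y =
    - (\<integral>(t, \<omega>). h (flow t \<omega> x) - h (flow t \<omega> y) \<partial>(T \<Otimes>\<^sub>M M))"
  using Bochner_Integration.integral_diff[OF integrable_flow_minus_Z[OF assms(1)] integrable_flow_minus_Z[OF assms(2)]]
  by (simp add: stein_solution_eq assms case_prod_unfold)

lemma abs_h_flow_diff_le:
  assumes "x \<in> orthant" "y \<in> orthant"
  shows "\<bar>h (flow t \<omega> x) - h (flow t \<omega> y)\<bar> \<le> norm1 (flow t \<omega> x - flow t \<omega> y)"
  using lip flow_in_orthant[OF assms(1)] flow_in_orthant[OF assms(2)] unfolding lipschitz1_def
  by (metis mult_1)

text \<open>The contraction factor \<open>exp (- t / \<alpha>)\<close> of the flow has integral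
  \<alpha> over the half-line.\<close>

lemma stein_solution_lipschitz: "lipschitz1 \<alpha> (stein_solution \<alpha> M Z h)"
  unfolding lipschitz1_def
proof (intro ballI)
  fix x y :: "real ^ 'n" assume x: "x \<in> orthant" and y: "y \<in> orthant"
  have "\<bar>stein_solution \<alpha> M Z h x - stein_solution \<alpha> M Z h y\<bar>
      = norm (\<integral>(t, \<omega>). h (flow t \<omega> x) - h (flow t \<omega> y) \<partial>(T \<Otimes>\<^sub>M M))"
    by (simp add: stein_solution_diff[OF x y])
  also have "\<dots> \<le> (\<integral>(t, \<omega>). exp (- t / \<alpha>) * norm1 (x - y) \<partial>(T \<Otimes>\<^sub>M M))"
  proof (rule norm_integral_le_integral[OF integrable_flow_diff[OF x y]])
    show "integrable (T \<Otimes>\<^sub>M M) (\<lambda>(t, \<omega>). exp (- t / \<alpha>) * norm1 (x - y))"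
      using alpha_gt_1 by (intro integrable_Q_mult integrable_exp_scaled) auto
    show "norm (case p of (t, \<omega>) \<Rightarrow> h (flow t \<omega> x) - h (flow t \<omega> y)) \<le>
        (case p of (t, \<omega>) \<Rightarrow> exp (- t / \<alpha>) * norm1 (x - y))" for p
      using order_trans[OF abs_h_flow_diff_le[OF x y] norm1_flow_diff_le] by (simp add: split_beta)
  qed
  also have "\<dots> = \<alpha> * norm1 (x - y)"
    using integrable_Q_exp(2) by (simp add: case_prod_unfold)
  finally show "\<bar>stein_solution \<alpha> M Z h x - stein_solution \<alpha> M Z h y\<bar> \<le> \<alpha> * norm1 (x - y)" .
qed

end

end

section \<open>Partial derivatives of the Stein solution\<close>

context max_stable_setting
begin

text \<open>
  \<open>gate j (x $ j) t \<omega>\<close> is the derivative of the \<open>j\<close>-th coordinate of \<open>flow t \<omega> x\<close> with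
  respect to \<open>x $ j\<close>, except at ties.
\<close>

definition gate :: "'n \<Rightarrow> real \<Rightarrow> real \<Rightarrow> 'a \<Rightarrow> real" where
  "gate j s t \<omega> =
    (if (1 - exp (- t)) powr (1 / \<alpha>) * Z \<omega> $ j \<le> exp (- t / \<alpha>) * s then exp (- t / \<alpha>) else 0)"

lemma measurable_Z_snd [measurable]: "(\<lambda>p. Z (snd p) $ j) \<in> borel_measurable (T \<Otimes>\<^sub>M M)"
  by (rule measurable_compose[OF measurable_snd measurable_Z_nth])

lemma measurable_gate: "(\<lambda>(t, \<omega>). gate j s t \<omega>) \<in> borel_measurable (T \<Otimes>\<^sub>M M)"
  unfolding gate_def split_beta by measurable

lemma gate_bounds: "0 \<le> gate j s t \<omega>" "gate j s t \<omega> \<le> exp (- (t / \<alpha>))"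
  by (simp_all add: gate_def)

lemma integrable_gate: "integrable (T \<Otimes>\<^sub>M M) (\<lambda>(t, \<omega>). gate j s t \<omega>)"
  by (rule Bochner_Integration.integrable_bound[OF integrable_Q_exp(1) measurable_gate])
     (auto intro!: AE_I2 simp: gate_bounds)

lemma expectation_if_const:
  assumes [measurable]: "Measurable.pred M P"
  shows "(\<integral>\<omega>. (if P \<omega> then c else 0) \<partial>M) = c * prob {\<omega> \<in> space M. P \<omega>}"
proof -
  have "(\<integral>\<omega>. (if P \<omega> then c else 0) \<partial>M) = (\<integral>\<omega>. c * indicator {\<omega> \<in> space M. P \<omega>} \<omega> \<partial>M)"
    by (intro Bochner_Integration.integral_cong) (auto simp: indicator_def)
  then show ?thesis by simp
qed

text \<open>Ignoring the event in the gate gives \<alpha>. Bounding the factor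
  \<open>exp (- t / \<alpha>)\<close> by 1 and keeping the event leaves its Frechet probability,
  which \<open>t \<le> exp t - 1\<close> turns into an exponential in \<open>t\<close> with integral
  \<open>s powr \<alpha>\<close>.\<close>

lemma integral_gate_le:
  assumes s: "0 \<le> s"
  shows "(\<integral>(t, \<omega>). gate j s t \<omega> \<partial>(T \<Otimes>\<^sub>M M)) \<le> min \<alpha> (s powr \<alpha>)"
proof -
  have "(\<integral>(t, \<omega>). gate j s t \<omega> \<partial>(T \<Otimes>\<^sub>M M)) \<le> (\<integral>(t, \<omega>). exp (- t / \<alpha>) \<partial>(T \<Otimes>\<^sub>M M))"
    by (rule integral_mono[OF integrable_gate integrable_Q_exp(1)]) (auto simp: gate_bounds)
  then have 1: "(\<integral>(t, \<omega>). gate j s t \<omega> \<partial>(T \<Otimes>\<^sub>M M)) \<le> \<alpha>" using integrable_Q_exp(2) by simp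
  have 2: "(\<integral>(t, \<omega>). gate j s t \<omega> \<partial>(T \<Otimes>\<^sub>M M)) \<le> s powr \<alpha>"
  proof (cases "s = 0")
    \<comment> \<open>For \<open>s = 0\<close> the event is empty, as \<open>Z\<close> has positive
      coordinates; the Frechet formula is available only for \<open>s > 0\<close>.\<close>
    case True
    have "(\<integral>(t, \<omega>). gate j s t \<omega> \<partial>(T \<Otimes>\<^sub>M M)) = (\<integral>p. 0 \<partial>(T \<Otimes>\<^sub>M M))"
    proof (rule Bochner_Integration.integral_cong[OF refl])
      fix p assume "p \<in> space (T \<Otimes>\<^sub>M M)"
      then obtain t \<omega> where p: "p = (t, \<omega>)" "0 < t" "\<omega> \<in> space M"
        by (auto simp: space_pair_measure space_T)
      have "0 < (1 - exp (- t)) powr (1 / \<alpha>) * Z \<omega> $ j"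
        using scale_bounds(3)[OF alpha_gt_1 p(2)] Z_pos[OF p(3)] by (rule mult_pos_pos)
      then show "(case p of (t, \<omega>) \<Rightarrow> gate j s t \<omega>) = 0" using True p(1) by (simp add: gate_def)
    qed
    then show ?thesis using True by simp
  next
    case False
    then have s: "0 < s" using assms by simp
    have "(\<integral>(t, \<omega>). gate j s t \<omega> \<partial>(T \<Otimes>\<^sub>M M)) = (\<integral>t. \<integral>\<omega>. gate j s t \<omega> \<partial>M \<partial>T)"
      using Q.integral_fst[OF integrable_gate] by simp
    also have "\<dots> \<le> (\<integral>t. exp (- t / (s powr \<alpha>)) \<partial>T)"
    proof (rule integral_mono)
      show "integrable T (\<lambda>t. \<integral>\<omega>. gate j s t \<omega> \<partial>M)"
        using Q.integrable_fst'[OF integrable_gate] by simp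
      show "integrable T (\<lambda>t. exp (- t / (s powr \<alpha>)))"
        using s by (intro integrable_exp_scaled) simp
      fix t assume "t \<in> space T"
      then have t: "0 < t" by (simp add: space_T)
      define a b where "a = exp (- t / \<alpha>)" and "b = (1 - exp (- t)) powr (1 / \<alpha>)"
      note sc = scale_bounds[OF alpha_gt_1 t, folded a_def b_def]
      have "(\<integral>\<omega>. gate j s t \<omega> \<partial>M) = a * prob {\<omega> \<in> space M. b * Z \<omega> $ j \<le> a * s}"
        unfolding gate_def a_def b_def by (rule expectation_if_const) measurable
      also have "{\<omega> \<in> space M. b * Z \<omega> $ j \<le> a * s} = {\<omega> \<in> space M. Z \<omega> $ j \<le> a / b * s}"
        using sc(3) by (auto simp: field_simps)
      also have "prob \<dots> = exp (- ((a / b * s) powr - \<alpha>))"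
        using sc(1,3) s by (intro prob_Z_nth_le) simp
      also have "(a / b * s) powr - \<alpha> = (exp t - 1) * s powr - \<alpha>"
        using sc(7) sc(1,3) s by (subst powr_mult) auto
      also have "a * exp (- ((exp t - 1) * s powr - \<alpha>)) \<le> 1 * exp (- (t * s powr - \<alpha>))"
      proof (rule mult_mono)
        have "t \<le> exp t - 1" using exp_ge_add_one_self[of t] by linarith
        then show "exp (- ((exp t - 1) * s powr - \<alpha>)) \<le> exp (- (t * s powr - \<alpha>))"
          using mult_right_mono[of t "exp t - 1" "s powr - \<alpha>"] by simp
      qed (use sc in auto)
      also have "1 * exp (- (t * s powr - \<alpha>)) = exp (- t / (s powr \<alpha>))"
        by (simp add: powr_minus divide_inverse)
      finally show "(\<integral>\<omega>. gate j s t \<omega> \<partial>M) \<le> exp (- t / (s powr \<alpha>))" .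
    qed
    also have "\<dots> = s powr \<alpha>" using s by (intro integrable_exp_scaled(2)) simp
    finally show ?thesis .
  qed
  from 1 2 show ?thesis by simp
qed

lemma flow_upd:
  "flow t \<omega> (upd x j s) =
    upd (flow t \<omega> x) j (max (exp (- t / \<alpha>) * s) ((1 - exp (- t)) powr (1 / \<alpha>) * Z \<omega> $ j))"
  by (simp add: vec_eq_iff flow_nth upd_def)

text \<open>Away from a tie one branch of the maximum is active near \<open>x $ j\<close>. On the
  constant branch the derivative is 0; on the linear one the chain rule applies within the
  half-line, because multiplication by \<open>a\<close> maps the half-line into itself.\<close>

lemma has_derivative_h_flow:
  assumes x: "x \<in> orthant" and diff: "partial_diff j h (flow t \<omega> x)"
    and ne: "(1 - exp (- t)) powr (1 / \<alpha>) * Z \<omega> $ j \<noteq> exp (- t / \<alpha>) * x $ j"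
  shows "((\<lambda>s. h (flow t \<omega> (upd x j s))) has_real_derivative
    gate j (x $ j) t \<omega> * partial j h (flow t \<omega> x)) (at (x $ j) within {0..})"
proof -
  define a c where "a = exp (- t / \<alpha>)" and "c = (1 - exp (- t)) powr (1 / \<alpha>) * Z \<omega> $ j"
  define y where "y = flow t \<omega> x"
  have a: "0 < a" by (simp add: a_def)
  have x0: "0 \<le> x $ j" using x by (simp add: orthant_iff)
  have flow: "h (flow t \<omega> (upd x j s)) = h (upd y j (max (a * s) c))" for s
    by (simp add: flow_upd a_def c_def y_def)
  have yj: "y $ j = max (a * x $ j) c" by (simp add: y_def flow_nth a_def c_def)
  have gate: "gate j (x $ j) t \<omega> = (if c \<le> a * x $ j then a else 0)"
    by (simp add: gate_def a_def c_def)
  have "((\<lambda>s. h (upd y j (max (a * s) c))) has_real_derivative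
      (if c \<le> a * x $ j then a else 0) * partial j h y) (at (x $ j) within {0..})"
  proof (cases "c \<le> a * x $ j")
    case False
    have "((\<lambda>s. h (upd y j c)) has_real_derivative 0) (at (x $ j) within {0..})" by simp
    \<comment> \<open>The branches switch at \<open>s = c / a\<close>; the radius \<open>d\<close>
      is the distance from \<open>x $ j\<close> to that point.\<close>
    then have "((\<lambda>s. h (upd y j (max (a * s) c))) has_real_derivative 0) (at (x $ j) within {0..})"
    proof (rule has_field_derivative_transform_within[where d = "(c - a * x $ j) / a"])
      fix s assume "dist s (x $ j) < (c - a * x $ j) / a"
      then have "a * \<bar>s - x $ j\<bar> < c - a * x $ j" using a by (simp add: dist_real_def field_simps)
      moreover have "a * (s - x $ j) \<le> a * \<bar>s - x $ j\<bar>" using a by simp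
      ultimately have "a * s < c" by (simp add: right_diff_distrib)
      then show "h (upd y j c) = h (upd y j (max (a * s) c))" by (simp add: max_def)
    qed (use False a x0 in auto)
    then show ?thesis using False by simp
  next
    case True
    then have lt: "c < a * x $ j" using ne by (simp add: a_def c_def)
    then have yj': "y $ j = a * x $ j" using yj by simp
    have "((\<lambda>s. h (upd y j s)) has_real_derivative partial j h y) (at (a * x $ j) within {0..})"
      using partial_works[OF diff] by (simp add: y_def[symmetric] yj')
    then have "((\<lambda>s. h (upd y j s)) has_real_derivative partial j h y) (at (a * x $ j) within (*) a ` {0..})"
      by (rule has_field_derivative_subset) (use a in auto)
    moreover have "((*) a has_real_derivative a) (at (x $ j) within {0..})"
      by (auto intro!: derivative_eq_intros)
    ultimately have "((\<lambda>s. h (upd y j s)) \<circ> (*) a has_real_derivative partial j h y * a) (at (x $ j) within {0..})"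
      by (rule DERIV_image_chain)
    then have "((\<lambda>s. h (upd y j (max (a * s) c))) has_real_derivative partial j h y * a) (at (x $ j) within {0..})"
    proof (rule has_field_derivative_transform_within[where d = "(a * x $ j - c) / a"])
      fix s assume "dist s (x $ j) < (a * x $ j - c) / a"
      then have "a * \<bar>s - x $ j\<bar> < a * x $ j - c" using a by (simp add: dist_real_def field_simps)
      moreover have "a * (x $ j - s) \<le> a * \<bar>s - x $ j\<bar>" using a by simp
      ultimately have "c < a * s" by (simp add: right_diff_distrib)
      then show "((\<lambda>s. h (upd y j s)) \<circ> (*) a) s = h (upd y j (max (a * s) c))" by (simp add: max_def)
    qed (use lt a x0 in auto)
    then show ?thesis using True by (simp add: mult.commute)
  qed
  then show ?thesis by (simp only: flow gate y_def)
qed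

text \<open>
  For fixed \<open>\<omega>\<close> a tie occurs at no more than one time \<open>t\<close>, since \<open>a / b\<close> is injective in \<open>t\<close>.
\<close>

lemma AE_no_tie:
  assumes s: "0 \<le> s"
  shows "AE (t, \<omega>) in T \<Otimes>\<^sub>M M. (1 - exp (- t)) powr (1 / \<alpha>) * Z \<omega> $ j \<noteq> exp (- t / \<alpha>) * s"
proof -
  let ?P = "\<lambda>t \<omega>. (1 - exp (- t)) powr (1 / \<alpha>) * Z \<omega> $ j \<noteq> exp (- t / \<alpha>) * s"
  have meas: "{p \<in> space (T \<Otimes>\<^sub>M M). ?P (fst p) (snd p)} \<in> sets (T \<Otimes>\<^sub>M M)"
    by measurable
  have "AE \<omega> in M. AE t in T. ?P t \<omega>"
  proof (rule AE_I2)
    fix \<omega> assume \<omega>: "\<omega> \<in> space M"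
    \<comment> \<open>A tie means \<open>a / b = Z \<omega> $ j / s\<close>, and
      \<open>(a / b) powr - \<alpha> = exp t - 1\<close> is then solved for \<open>t\<close>. No tie
      is possible at \<open>s = 0\<close>.\<close>
    have uniq: "t = ln (1 + (Z \<omega> $ j / s) powr - \<alpha>)"
      if t: "0 < t" and eq: "(1 - exp (- t)) powr (1 / \<alpha>) * Z \<omega> $ j = exp (- t / \<alpha>) * s" for t
    proof -
      define a b where "a = exp (- t / \<alpha>)" and "b = (1 - exp (- t)) powr (1 / \<alpha>)"
      note sc = scale_bounds[OF alpha_gt_1 t, folded a_def b_def]
      have eq: "b * Z \<omega> $ j = a * s" using eq by (simp add: a_def b_def)
      then have "s \<noteq> 0" using sc(3) Z_pos[OF \<omega>, of j] by auto
      then have "a / b = Z \<omega> $ j / s" using eq sc(3) by (simp add: field_simps)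
      then have "(Z \<omega> $ j / s) powr - \<alpha> = exp t - 1" using sc(7) by simp
      then show ?thesis by simp
    qed
    show "AE t in T. ?P t \<omega>"
      by (subst AE_restrict_space_iff, simp, rule AE_mp[OF AE_lborel_singleton[of "ln (1 + (Z \<omega> $ j / s) powr - \<alpha>)"]])
         (use uniq in auto)
  qed
  \<comment> \<open>The exceptional times form a null set for each \<omega>, while the product lists
    time first; measurability of the no-tie set permits the exchange.\<close>
  then have "AE t in T. AE \<omega> in M. ?P t \<omega>"
    using Q.AE_commute[OF meas] by simp
  then show ?thesis
    using Q.AE_pair_measure[of "\<lambda>p. ?P (fst p) (snd p)"] meas by (simp add: case_prod_unfold)
qed

context
  fixes h :: "real ^ 'n \<Rightarrow> real"
  assumes lip: "lipschitz1 1 h" and C1: "h \<in> C1"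
begin

lemma diff_h: "x \<in> orthant \<Longrightarrow> partial_diff j h x"
  and cont_partial_h: "continuous_on orthant (partial j h)"
  using C1 by (auto simp: C1_def)

lemma integrable_gate_partial:
  assumes x: "x \<in> orthant"
  shows "integrable (T \<Otimes>\<^sub>M M) (\<lambda>(t, \<omega>). gate j s t \<omega> * partial j h (flow t \<omega> x))"
proof (rule Bochner_Integration.integrable_bound[OF integrable_gate[of j s]])
  show "(\<lambda>(t, \<omega>). gate j s t \<omega> * partial j h (flow t \<omega> x)) \<in> borel_measurable (T \<Otimes>\<^sub>M M)"
    using borel_measurable_times[OF measurable_gate measurable_flow_compose[OF cont_partial_h x]]
    by (simp add: case_prod_unfold)
  show "AE p in T \<Otimes>\<^sub>M M. norm (case p of (t, \<omega>) \<Rightarrow> gate j s t \<omega> * partial j h (flow t \<omega> x))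
      \<le> norm (case p of (t, \<omega>) \<Rightarrow> gate j s t \<omega>)"
    using abs_partial_le[OF lip diff_h flow_in_orthant[OF x], OF flow_in_orthant[OF x]]
    by (auto intro!: AE_I2 mult_left_le simp: abs_mult)
qed

text \<open>Differentiation under the integral by dominated convergence along sequences: the
  difference quotients converge off ties, and the contraction of the flow dominates them by
  \<open>exp (- t / \<alpha>)\<close>.\<close>

lemma stein_solution_has_derivative:
  assumes x: "x \<in> orthant"
  shows "((\<lambda>s. stein_solution \<alpha> M Z h (upd x j s)) has_real_derivative
    - (\<integral>(t, \<omega>). gate j (x $ j) t \<omega> * partial j h (flow t \<omega> x) \<partial>(T \<Otimes>\<^sub>M M))) (at (x $ j) within {0..})"
  unfolding has_field_derivative_iff tendsto_at_iff_sequentially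
proof (intro allI impI)
  fix X assume X: "\<forall>i. X i \<in> {0..} - {x $ j}" and lim: "X \<longlonglongrightarrow> x $ j"
  define q where "q i = (\<lambda>(t, \<omega>). (h (flow t \<omega> (upd x j (X i))) - h (flow t \<omega> x)) / (X i - x $ j))" for i
  have upd: "upd x j (X i) \<in> orthant" for i using X x by (intro upd_in_orthant) auto
  have int: "integrable (T \<Otimes>\<^sub>M M) (q i)" for i
    using integrable_divide[OF integrable_flow_diff[OF lip upd[of i] x], of "X i - x $ j"]
    by (simp add: q_def case_prod_unfold)
  have "(\<lambda>i. \<integral>p. q i p \<partial>(T \<Otimes>\<^sub>M M)) \<longlonglongrightarrow>
      (\<integral>(t, \<omega>). gate j (x $ j) t \<omega> * partial j h (flow t \<omega> x) \<partial>(T \<Otimes>\<^sub>M M))"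
  proof (rule integral_dominated_convergence)
    show "(\<lambda>(t, \<omega>). gate j (x $ j) t \<omega> * partial j h (flow t \<omega> x)) \<in> borel_measurable (T \<Otimes>\<^sub>M M)"
      using integrable_gate_partial[OF x] by auto
    show "q i \<in> borel_measurable (T \<Otimes>\<^sub>M M)" for i using int by auto
    show "integrable (T \<Otimes>\<^sub>M M) (\<lambda>(t, \<omega>). exp (- t / \<alpha>))" by (rule integrable_Q_exp)
    show "AE p in T \<Otimes>\<^sub>M M. (\<lambda>i. q i p) \<longlonglongrightarrow> (case p of (t, \<omega>) \<Rightarrow> gate j (x $ j) t \<omega> * partial j h (flow t \<omega> x))"
      using AE_no_tie[of "x $ j" j, OF x[unfolded orthant_iff, rule_format]]
    proof eventually_elim
      case (elim p)
      obtain t \<omega> where p: "p = (t, \<omega>)" by force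
      have "((\<lambda>s. h (flow t \<omega> (upd x j s))) has_real_derivative
          gate j (x $ j) t \<omega> * partial j h (flow t \<omega> x)) (at (x $ j) within {0..})"
        using elim by (intro has_derivative_h_flow x diff_h flow_in_orthant) (simp add: p)
      then show ?case
        unfolding has_field_derivative_iff tendsto_at_iff_sequentially
        using X lim by (auto simp: q_def p o_def)
    qed
    show "AE p in T \<Otimes>\<^sub>M M. norm (q i p) \<le> (case p of (t, \<omega>) \<Rightarrow> exp (- t / \<alpha>))" for i
    proof (rule AE_I2)
      fix p :: "real \<times> 'a"
      obtain t \<omega> where p: "p = (t, \<omega>)" by force
      have ne: "X i \<noteq> x $ j" using X by auto
      have "norm1 (upd x j (X i) - x) = \<bar>X i - x $ j\<bar>" using norm1_upd[of x j "X i" "x $ j"] by simp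
      then have "\<bar>h (flow t \<omega> (upd x j (X i))) - h (flow t \<omega> x)\<bar> \<le> exp (- t / \<alpha>) * \<bar>X i - x $ j\<bar>"
        using order_trans[OF abs_h_flow_diff_le[OF lip upd x] norm1_flow_diff_le] by metis
      then show "norm (q i p) \<le> (case p of (t, \<omega>) \<Rightarrow> exp (- t / \<alpha>))"
        using ne by (simp add: q_def p divide_le_eq)
    qed
  qed
  moreover have "(stein_solution \<alpha> M Z h (upd x j (X i)) - stein_solution \<alpha> M Z h (upd x j (x $ j))) / (X i - x $ j)
      = - (\<integral>p. q i p \<partial>(T \<Otimes>\<^sub>M M))" for i
    using stein_solution_diff[OF lip upd x, of i]
    by (simp add: q_def case_prod_unfold)
  ultimately show "((\<lambda>s. (stein_solution \<alpha> M Z h (upd x j s) - stein_solution \<alpha> M Z h (upd x j (x $ j))) / (s - x $ j)) \<circ> X)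
      \<longlonglongrightarrow> - (\<integral>(t, \<omega>). gate j (x $ j) t \<omega> * partial j h (flow t \<omega> x) \<partial>(T \<Otimes>\<^sub>M M))"
    by (simp add: o_def tendsto_minus)
qed

lemmas partial_diff_stein_solution = partial_eqI(1)[OF _ stein_solution_has_derivative]
lemmas partial_stein_solution = partial_eqI(2)[OF _ stein_solution_has_derivative]

text \<open>The partial derivatives of \<open>h\<close> are at most 1 in absolute value, so the
  integrand is dominated by the gate.\<close>

lemma abs_partial_stein_solution_le:
  assumes x: "x \<in> orthant"
  shows "\<bar>partial j (stein_solution \<alpha> M Z h) x\<bar> \<le> min \<alpha> (x $ j powr \<alpha>)"
proof -
  have "\<bar>partial j (stein_solution \<alpha> M Z h) x\<bar> =
      norm (\<integral>(t, \<omega>). gate j (x $ j) t \<omega> * partial j h (flow t \<omega> x) \<partial>(T \<Otimes>\<^sub>M M))"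
    by (simp add: partial_stein_solution[OF x x])
  also have "\<dots> \<le> (\<integral>(t, \<omega>). gate j (x $ j) t \<omega> \<partial>(T \<Otimes>\<^sub>M M))"
  proof (rule norm_integral_le_integral[OF integrable_gate_partial[OF x] integrable_gate])
    show "norm (case p of (t, \<omega>) \<Rightarrow> gate j (x $ j) t \<omega> * partial j h (flow t \<omega> x)) \<le> (case p of (t, \<omega>) \<Rightarrow> gate j (x $ j) t \<omega>)" for p
      using abs_partial_le[OF lip diff_h flow_in_orthant[OF x], OF flow_in_orthant[OF x]]
      by (auto intro!: mult_left_le simp: abs_mult gate_bounds split: prod.split)
  qed
  also have "\<dots> \<le> min \<alpha> (x $ j powr \<alpha>)"
    using x by (intro integral_gate_le) (simp add: orthant_iff)
  finally show ?thesis .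
qed

end

end

section \<open>The generator and the second-order bound\<close>

context max_stable_setting
begin

text \<open>Replacing \<open>x\<close> by \<open>sup x y\<close> moves the \<open>j\<close>-th
  coordinate of the flow only if \<open>a * y $ j\<close> exceeds the \<open>Z\<close> term, and
  then by at most \<open>a * y $ j\<close>.\<close>

lemma norm1_flow_sup_le:
  assumes x: "x \<in> orthant" and y: "y \<in> orthant"
  shows "norm1 (flow t \<omega> (sup x y) - flow t \<omega> x) \<le> (\<Sum>j\<in>UNIV. y $ j * gate j (y $ j) t \<omega>)"
  unfolding norm1_def
proof (rule sum_mono)
  fix j
  define a c where "a = exp (- t / \<alpha>)" and "c = (1 - exp (- t)) powr (1 / \<alpha>) * Z \<omega> $ j"
  have a: "0 < a" by (simp add: a_def)
  have xy: "0 \<le> x $ j" "0 \<le> y $ j" using x y by (auto simp: orthant_iff)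
  have "\<bar>max (a * max (x $ j) (y $ j)) c - max (a * x $ j) c\<bar> \<le> y $ j * (if c \<le> a * y $ j then a else 0)"
  proof (cases "x $ j < y $ j")
    case True
    then have "a * x $ j < a * y $ j" using a by simp
    moreover have "0 \<le> a * x $ j" using a xy by simp
    ultimately show ?thesis using True by (auto simp: max_def mult.commute)
  next
    case False
    then show ?thesis using a xy by (simp add: max_def)
  qed
  then show "\<bar>(flow t \<omega> (sup x y) - flow t \<omega> x) $ j\<bar> \<le> y $ j * gate j (y $ j) t \<omega>"
    unfolding vector_minus_component flow_nth sup_vec_nth gate_def a_def c_def .
qed

lemma sup_in_orthant: "x \<in> orthant \<Longrightarrow> sup x y \<in> orthant"
  by (simp add: orthant_iff le_max_iff_disj)

text \<open>Integrating the gates of \<open>norm1_flow_sup_le\<close> gives a bound that depends on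
  \<open>y\<close> only, in exactly the form that \<open>integrable_exponent_bound\<close>
  takes.\<close>

lemma abs_stein_solution_sup_diff_le:
  assumes lip: "lipschitz1 1 h" and x: "x \<in> orthant" and y: "y \<in> orthant"
  shows "\<bar>stein_solution \<alpha> M Z h (sup x y) - stein_solution \<alpha> M Z h x\<bar>
    \<le> (\<Sum>j\<in>UNIV. y $ j * min \<alpha> (y $ j powr \<alpha>))"
proof -
  have sum_int: "integrable (T \<Otimes>\<^sub>M M) (\<lambda>p. \<Sum>j\<in>UNIV. y $ j * (case p of (t, \<omega>) \<Rightarrow> gate j (y $ j) t \<omega>))"
    by (intro Bochner_Integration.integrable_sum integrable_mult_right integrable_gate)
  have "\<bar>stein_solution \<alpha> M Z h (sup x y) - stein_solution \<alpha> M Z h x\<bar>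
      = norm (\<integral>(t, \<omega>). h (flow t \<omega> (sup x y)) - h (flow t \<omega> x) \<partial>(T \<Otimes>\<^sub>M M))"
    by (simp add: stein_solution_diff[OF lip sup_in_orthant[OF x] x])
  also have "\<dots> \<le> (\<integral>p. (\<Sum>j\<in>UNIV. y $ j * (case p of (t, \<omega>) \<Rightarrow> gate j (y $ j) t \<omega>)) \<partial>(T \<Otimes>\<^sub>M M))"
  proof (rule norm_integral_le_integral[OF integrable_flow_diff[OF lip sup_in_orthant[OF x] x] sum_int])
    show "norm (case p of (t, \<omega>) \<Rightarrow> h (flow t \<omega> (sup x y)) - h (flow t \<omega> x)) \<le>
        (\<Sum>j\<in>UNIV. y $ j * (case p of (t, \<omega>) \<Rightarrow> gate j (y $ j) t \<omega>))" for p
      using order_trans[OF abs_h_flow_diff_le[OF lip sup_in_orthant[OF x] x] norm1_flow_sup_le[OF x y]]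
      by (simp add: split_beta)
  qed
  also have "\<dots> = (\<Sum>j\<in>UNIV. y $ j * (\<integral>(t, \<omega>). gate j (y $ j) t \<omega> \<partial>(T \<Otimes>\<^sub>M M)))"
    using integrable_gate by (subst Bochner_Integration.integral_sum) (auto simp: case_prod_unfold)
  also have "\<dots> \<le> (\<Sum>j\<in>UNIV. y $ j * min \<alpha> (y $ j powr \<alpha>))"
    using y by (intro sum_mono mult_left_mono integral_gate_le) (auto simp: orthant_iff)
  finally show ?thesis .
qed

lemma D_op_finite_stein_solution:
  assumes lip: "lipschitz1 1 h" and x: "x \<in> E0"
  shows "D_op_finite \<alpha> \<nu> (stein_solution \<alpha> M Z h) x"
proof -
  let ?g = "stein_solution \<alpha> M Z h"
  have x: "x \<in> orthant" using x by (simp add: E0_def)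
  \<comment> \<open>Needed for continuity and hence measurability of the integrand; the maximum with
    \<open>x\<close> is 1-Lipschitz in each coordinate.\<close>
  have "lipschitz1 \<alpha> (\<lambda>y. ?g (sup x y) - ?g x)"
    unfolding lipschitz1_def
  proof (intro ballI)
    fix y z :: "real ^ 'n"
    have "\<bar>?g (sup x y) - ?g (sup x z)\<bar> \<le> \<alpha> * norm1 (sup x y - sup x z)"
      using stein_solution_lipschitz[OF lip] sup_in_orthant[OF x] unfolding lipschitz1_def by blast
    also have "\<dots> \<le> \<alpha> * norm1 (y - z)"
      using alpha_gt_1 unfolding norm1_def by (intro mult_left_mono sum_mono) (auto simp: max_def)
    finally show "\<bar>?g (sup x y) - ?g x - (?g (sup x z) - ?g x)\<bar> \<le> \<alpha> * norm1 (y - z)" by simp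
  qed
  then have "continuous_on E0 (\<lambda>y. ?g (sup x y) - ?g x)"
    by (rule continuous_on_subset[OF lipschitz1_continuous_on]) (auto simp: E0_def)
  then have "integrable (exponent_measure \<alpha> \<nu>) (\<lambda>y. ?g (sup x y) - ?g x)"
    using abs_stein_solution_sup_diff_le[OF lip x]
    by (intro integrable_exponent_bound borel_measurable_continuous_on_restrict) (auto simp: E0_def)
  then show ?thesis unfolding D_op_finite_def D_op_def by (rule has_bochner_integral_integrable)
qed

section \<open>The Lipschitz bound for the partial derivatives\<close>

lemma C2_bounds:
  defines "c \<equiv> (\<lambda>t. (real CARD('n) - 1) * exp (- t / \<alpha>) + \<alpha> * (exp t - 1) powr (- 1 / \<alpha>))"
  shows "integrable T c" and "C2 TYPE('n) \<alpha> = integral\<^sup>L T c"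
    and "\<alpha> * (exp t - 1) powr (- 1 / \<alpha>) \<le> c t"
proof -
  show "integrable T c"
    unfolding c_def using integrable_exp_scaled(1)[of \<alpha>] integrable_exp_minus_1_powr[of \<alpha>] alpha_gt_1
    by (intro Bochner_Integration.integrable_add integrable_mult_right) auto
  show "C2 TYPE('n) \<alpha> = integral\<^sup>L T c"
    by (simp add: C2_def c_def integral_restrict_space set_lebesgue_integral_def)
  \<comment> \<open>Hence the first summand of the integrand is nonnegative.\<close>
  have "1 \<le> CARD('n)" by (simp add: Suc_leI)
  then show "\<alpha> * (exp t - 1) powr (- 1 / \<alpha>) \<le> c t" by (simp add: c_def)
qed

text \<open>Division by \<open>b\<close> turns the event into an interval for
  \<open>Z \<omega> $ j\<close> of length \<open>a / b * (v - u)\<close>, to which the bound on the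
  Frechet density applies.\<close>

lemma prob_gate_between:
  assumes t: "0 < t" and "0 \<le> u" "u \<le> v"
  shows "prob {\<omega> \<in> space M. exp (- t / \<alpha>) * u < (1 - exp (- t)) powr (1 / \<alpha>) * Z \<omega> $ j \<and>
      (1 - exp (- t)) powr (1 / \<alpha>) * Z \<omega> $ j \<le> exp (- t / \<alpha>) * v}
    \<le> 16 / 25 * \<alpha> * (exp t - 1) powr (- 1 / \<alpha>) * (v - u)"
proof -
  define a b where "a = exp (- t / \<alpha>)" and "b = (1 - exp (- t)) powr (1 / \<alpha>)"
  note sc = scale_bounds[OF alpha_gt_1 t, folded a_def b_def]
  have "{\<omega> \<in> space M. a * u < b * Z \<omega> $ j \<and> b * Z \<omega> $ j \<le> a * v} =
      {\<omega> \<in> space M. a / b * u < Z \<omega> $ j \<and> Z \<omega> $ j \<le> a / b * v}"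
    using sc(3) by (auto simp: field_simps)
  moreover have "prob \<dots> \<le> 16 / 25 * \<alpha> * (a / b * v - a / b * u)"
    using sc assms by (intro prob_Z_nth_between) (auto intro!: mult_left_mono divide_right_mono)
  moreover have "16 / 25 * \<alpha> * (a / b * v - a / b * u) = 16 / 25 * \<alpha> * (exp t - 1) powr (- 1 / \<alpha>) * (v - u)"
    unfolding sc(6) by (simp add: algebra_simps)
  ultimately show ?thesis unfolding a_def[symmetric] b_def[symmetric] by (simp only:)
qed

text \<open>The difference of the integrands splits into the gate at \<open>x\<close> times the
  change of \<open>k\<close>, and the change \<open>B\<close> of the gate times \<open>k\<close> at
  \<open>y\<close>. In the first term the gate and the contraction of the flow contribute one factor
  \<open>exp (- t / \<alpha>)\<close> each; the second is controlled by the Frechet density.\<close>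

lemma abs_partial_stein_solution_diff_le:
  fixes h :: "real ^ 'n \<Rightarrow> real"
  assumes lip: "lipschitz1 1 h" and C1: "h \<in> C1" and lip': "lipschitz1 1 (partial j h)"
    and x: "x \<in> orthant" and y: "y \<in> orthant" and le: "x $ j \<le> y $ j"
  shows "\<bar>partial j (stein_solution \<alpha> M Z h) x - partial j (stein_solution \<alpha> M Z h) y\<bar>
    \<le> C2 TYPE('n) \<alpha> * norm1 (x - y)"
proof -
  define k where "k = partial j h"
  define B where "B t \<omega> = (if exp (- t / \<alpha>) * x $ j < (1 - exp (- t)) powr (1 / \<alpha>) * Z \<omega> $ j \<and>
      (1 - exp (- t)) powr (1 / \<alpha>) * Z \<omega> $ j \<le> exp (- t / \<alpha>) * y $ j then exp (- t / \<alpha>) else 0)" for t \<omega>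
  define c where "c t = (real CARD('n) - 1) * exp (- t / \<alpha>) + \<alpha> * (exp t - 1) powr (- 1 / \<alpha>)" for t
  let ?n = "norm1 (x - y)"
  let ?F = "\<lambda>(t, \<omega>). (exp (- t / \<alpha>))\<^sup>2 * ?n + B t \<omega>"
  have diff: "partial_diff j h z" if "z \<in> orthant" for z using C1 that by (simp add: C1_def)
  \<comment> \<open>As \<open>x $ j \<le> y $ j\<close>, the gate at \<open>x\<close> is open only
    if that at \<open>y\<close> is, so their difference is \<open>exp (- t / \<alpha>)\<close> on an
    event and 0 off it.\<close>
  have B_diff: "B t \<omega> = gate j (y $ j) t \<omega> - gate j (x $ j) t \<omega>" for t \<omega>
    using mult_left_mono[OF le, of "exp (- t / \<alpha>)"] exp_ge_zero[of "- t / \<alpha>"] unfolding B_def gate_def by argo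
  have intB: "integrable (T \<Otimes>\<^sub>M M) (\<lambda>(t, \<omega>). B t \<omega>)"
    unfolding B_diff
    using Bochner_Integration.integrable_diff[OF integrable_gate[of j "y $ j"] integrable_gate[of j "x $ j"]]
    by (simp add: case_prod_unfold)
  have intA: "integrable (T \<Otimes>\<^sub>M M) (\<lambda>(t, \<omega>). (exp (- t / \<alpha>))\<^sup>2 * ?n)"
  proof (rule integrable_Q_mult)
    have "(exp (- t / \<alpha>))\<^sup>2 = exp (- t / (\<alpha> / 2))" for t
      by (simp add: exp_double[symmetric])
    then show "integrable T (\<lambda>t. (exp (- t / \<alpha>))\<^sup>2)"
      using integrable_exp_scaled(1)[of "\<alpha> / 2"] alpha_gt_1 by simp
  qed simp
  have intF: "integrable (T \<Otimes>\<^sub>M M) ?F"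
    using Bochner_Integration.integrable_add[OF intA intB] by (simp add: case_prod_unfold)
  note int = integrable_gate_partial[OF lip C1, where j = j, folded k_def]
  have "\<bar>partial j (stein_solution \<alpha> M Z h) x - partial j (stein_solution \<alpha> M Z h) y\<bar> =
      norm (\<integral>p. (case p of (t, \<omega>) \<Rightarrow> gate j (x $ j) t \<omega> * k (flow t \<omega> x)) -
        (case p of (t, \<omega>) \<Rightarrow> gate j (y $ j) t \<omega> * k (flow t \<omega> y)) \<partial>(T \<Otimes>\<^sub>M M))"
    by (subst Bochner_Integration.integral_diff[OF int[OF x] int[OF y]])
       (simp add: partial_stein_solution[OF lip C1 x x] partial_stein_solution[OF lip C1 y y] k_def)
  also have "\<dots> \<le> (\<integral>p. ?F p \<partial>(T \<Otimes>\<^sub>M M))"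
  proof (rule norm_integral_le_integral[OF Bochner_Integration.integrable_diff[OF int[OF x] int[OF y]] intF])
    fix p :: "real \<times> 'a"
    obtain t \<omega> where p: "p = (t, \<omega>)" by force
    define a where "a = exp (- t / \<alpha>)"
    have ky: "\<bar>k (flow t \<omega> y)\<bar> \<le> 1"
      unfolding k_def by (intro abs_partial_le[OF lip] diff flow_in_orthant y)
    have "\<bar>k (flow t \<omega> x) - k (flow t \<omega> y)\<bar> \<le> 1 * norm1 (flow t \<omega> x - flow t \<omega> y)"
      using lip' flow_in_orthant[OF x] flow_in_orthant[OF y] unfolding lipschitz1_def k_def by blast
    then have kd: "\<bar>k (flow t \<omega> x) - k (flow t \<omega> y)\<bar> \<le> a * ?n"
      using norm1_flow_diff_le[of t \<omega> x y] by (simp add: a_def)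
    have "gate j (x $ j) t \<omega> * k (flow t \<omega> x) - gate j (y $ j) t \<omega> * k (flow t \<omega> y) =
        gate j (x $ j) t \<omega> * (k (flow t \<omega> x) - k (flow t \<omega> y)) - B t \<omega> * k (flow t \<omega> y)"
      by (simp add: B_diff algebra_simps)
    also have "\<bar>\<dots>\<bar> \<le> \<bar>gate j (x $ j) t \<omega> * (k (flow t \<omega> x) - k (flow t \<omega> y))\<bar> + \<bar>B t \<omega> * k (flow t \<omega> y)\<bar>"
      by (rule abs_triangle_ineq4)
    also have "\<dots> \<le> a * (a * ?n) + B t \<omega>"
    proof (rule add_mono)
      show "\<bar>gate j (x $ j) t \<omega> * (k (flow t \<omega> x) - k (flow t \<omega> y))\<bar> \<le> a * (a * ?n)"
        unfolding abs_mult using kd by (intro mult_mono) (auto simp: gate_def a_def)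
      have "0 \<le> B t \<omega>" by (simp add: B_def)
      then show "\<bar>B t \<omega> * k (flow t \<omega> y)\<bar> \<le> B t \<omega>"
        using ky by (simp add: abs_mult mult_left_le)
    qed
    finally show "norm ((case p of (t, \<omega>) \<Rightarrow> gate j (x $ j) t \<omega> * k (flow t \<omega> x)) -
        (case p of (t, \<omega>) \<Rightarrow> gate j (y $ j) t \<omega> * k (flow t \<omega> y))) \<le> ?F p"
      by (simp add: p a_def power2_eq_square mult.assoc)
  qed
  also have "\<dots> = (\<integral>t. \<integral>\<omega>. (exp (- t / \<alpha>))\<^sup>2 * ?n + B t \<omega> \<partial>M \<partial>T)"
    using Q.integral_fst[OF intF] by simp
  also have "\<dots> \<le> (\<integral>t. c t * ?n \<partial>T)"
  proof (rule integral_mono)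
    show "integrable T (\<lambda>t. \<integral>\<omega>. (exp (- t / \<alpha>))\<^sup>2 * ?n + B t \<omega> \<partial>M)"
      using Q.integrable_fst'[OF intF] by simp
    show "integrable T (\<lambda>t. c t * ?n)" using C2_bounds(1) unfolding c_def by (rule integrable_mult_left)
    fix t assume "t \<in> space T"
    then have t: "0 < t" by (simp add: space_T)
    define a w where "a = exp (- t / \<alpha>)" and "w = (exp t - 1) powr (- 1 / \<alpha>)"
    have a: "0 < a" and w: "0 \<le> w" by (simp_all add: a_def w_def)
    have x0: "0 \<le> x $ j" using x by (simp add: orthant_iff)
    have B_eq: "(\<integral>\<omega>. B t \<omega> \<partial>M) = a * prob {\<omega> \<in> space M. a * x $ j < (1 - exp (- t)) powr (1 / \<alpha>) * Z \<omega> $ j \<and>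
      (1 - exp (- t)) powr (1 / \<alpha>) * Z \<omega> $ j \<le> a * y $ j}"
      unfolding B_def a_def by (rule expectation_if_const) measurable
    also have "\<dots> \<le> a * (16 / 25 * \<alpha> * w * (y $ j - x $ j))"
      using a prob_gate_between[OF t x0 le, of j] unfolding a_def w_def by (intro mult_left_mono) auto
    also have "\<dots> \<le> a * (16 / 25 * \<alpha> * w * ?n)"
      using a w alpha_gt_1 abs_nth_le_norm1[of "x - y" j] by (intro mult_left_mono) auto
    finally have B_le: "(\<integral>\<omega>. B t \<omega> \<partial>M) \<le> a * (16 / 25 * \<alpha> * w * ?n)" .
    have [measurable]: "B t \<in> borel_measurable M" unfolding B_def by measurable
    have "integrable M (B t)"
      by (rule integrable_const_bound[where B = 1]) (use scale_bounds(2)[OF alpha_gt_1 t] in \<open>auto simp: B_def\<close>)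
    then have "(\<integral>\<omega>. (exp (- t / \<alpha>))\<^sup>2 * ?n + B t \<omega> \<partial>M) = a\<^sup>2 * ?n + (\<integral>\<omega>. B t \<omega> \<partial>M)"
      by (simp add: a_def prob_space)
    also have "\<dots> \<le> (a\<^sup>2 + 16 / 25 * \<alpha> * a * w) * ?n" using B_le by (simp add: algebra_simps)
    \<comment> \<open>By \<open>scales_C2_bound\<close> the coefficient is at most the second
      summand of \<open>c t\<close>.\<close>
    also have "\<dots> \<le> c t * ?n"
      using order_trans[OF scales_C2_bound[OF alpha_gt_1 t] C2_bounds(3)] norm1_nonneg[of "x - y"]
      unfolding a_def w_def c_def by (intro mult_right_mono)
    finally show "(\<integral>\<omega>. (exp (- t / \<alpha>))\<^sup>2 * ?n + B t \<omega> \<partial>M) \<le> c t * ?n" .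
  qed
  also have "\<dots> = C2 TYPE('n) \<alpha> * ?n" unfolding C2_bounds(2) c_def by simp
  finally show ?thesis .
qed

text \<open>The two points enter symmetrically, so they may be ordered by their \<open>j\<close>-th
  coordinates.\<close>

lemma partial_stein_solution_lipschitz:
  assumes "lipschitz1 1 h" "h \<in> C1" "lipschitz1 1 (partial j h)"
  shows "lipschitz1 (C2 TYPE('n) \<alpha>) (partial j (stein_solution \<alpha> M Z h))"
  unfolding lipschitz1_def
proof (intro ballI)
  fix x y :: "real ^ 'n" assume x: "x \<in> orthant" and y: "y \<in> orthant"
  show "\<bar>partial j (stein_solution \<alpha> M Z h) x - partial j (stein_solution \<alpha> M Z h) y\<bar> \<le> C2 TYPE('n) \<alpha> * norm1 (x - y)"
  proof (cases "x $ j \<le> y $ j")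
    case True
    then show ?thesis by (rule abs_partial_stein_solution_diff_le[OF assms x y])
  next
    case False
    then have "\<bar>partial j (stein_solution \<alpha> M Z h) y - partial j (stein_solution \<alpha> M Z h) x\<bar> \<le> C2 TYPE('n) \<alpha> * norm1 (y - x)"
      by (intro abs_partial_stein_solution_diff_le[OF assms y x]) simp
    then show ?thesis by (simp add: abs_minus_commute norm1_def)
  qed
qed

end

theorem theorem6:
  fixes \<alpha> :: real
    and N :: "real ^ 'n \<Rightarrow> real"
    and \<nu> :: "(real ^ 'n) measure"
    and M :: "'a measure"
    and Z :: "'a \<Rightarrow> real ^ 'n"
    and h :: "real ^ 'n \<Rightarrow> real"
  assumes "is_norm N" and "pos_sphere N \<subseteq> {0..1}"
    and "\<alpha> > 1"
    and "angular_measure N \<nu>"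
    and "prob_space M" and "max_stable_vector \<alpha> \<nu> M Z"
    and "h \<in> C1 \<inter> Lip1"
  shows "lipschitz1 \<alpha> (stein_solution \<alpha> M Z h) \<and>
         (\<forall>j. \<forall>x\<in>orthant. partial_diff j (stein_solution \<alpha> M Z h) x \<and>
            \<bar>partial j (stein_solution \<alpha> M Z h) x\<bar> \<le> min \<alpha> (x $ j powr \<alpha>)) \<and>
         (\<forall>x\<in>E0. D_op_finite \<alpha> \<nu> (stein_solution \<alpha> M Z h) x) \<and>
         (h \<in> Lip21 \<longrightarrow>
            (\<forall>j. lipschitz1 (C2 TYPE('n) \<alpha>) (partial j (stein_solution \<alpha> M Z h))))"
proof -
  interpret max_stable_setting \<alpha> N \<nu> M Z
    unfolding max_stable_setting_def angular_setting_def max_stable_setting_axioms_def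
    using assms by simp
  have C1: "h \<in> C1" and lip: "lipschitz1 1 h" using assms(7) by (simp_all add: Lip1_def)
  show ?thesis
    using stein_solution_lipschitz[OF lip] partial_diff_stein_solution[OF lip C1]
      abs_partial_stein_solution_le[OF lip C1] D_op_finite_stein_solution[OF lip]
      partial_stein_solution_lipschitz[OF lip C1]
    by (auto simp: Lip21_def)
qed

end
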